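(* Let $A\in\mathbb{N}^{m\times n}$. If $\dim\mathcal{X}_{A,\otimes}=m$, then the degree of $\mathcal{X}_{A,\otimes}\subset\mathbb{C}^n$ is bounded by the following quantities: $$\deg\mathcal{X}_{A,\otimes}\ \le\ m!\cdot\operatorname{vol}(P_C)\ \le\ m!\cdot 2^{-m}\cdot\operatorname{vol}(P_B).$$
   Context: The Chebyshev polynomials of the first kind are defined by $T_0(t)=1$, $T_1(t)=t$, $T_{k+1}(t)=2t\,T_k(t)-T_{k-1}(t)$. Let $A=[a_1~\cdots~a_n]\in\mathbb{N}^{m\times n}$ have columns $a_j=(a_{1j},\ldots,a_{mj})$. For each $j$ put $\mathcal{T}_{a_j,\otimes}(t_1,\ldots,t_m)=T_{a_{1j}}(t_1)\cdots T_{a_{mj}}(t_m)$. The variety $\mathcal{X}_{A,\otimes}\subset\mathbb{C}^n$ is the Zariski closure of the image of $\mathbb{C}^m\to\mathbb{C}^n$, $t\mapsto(\mathcal{T}_{a_1,\otimes}(t),\ldots,\mathcal{T}_{a_n,\otimes}(t))$. The degree of a $d$-dimensional affine variety in $\mathbb{C}^n$ is the number of its intersection points with a generic affine-linear space of dimension $n-d$. For $j=1,\ldots,n$ let $B_j=\{-a_{1j},a_{1j}\}\times\cdots\times\{-a_{mj},a_{mj}\}\subset\mathbb{Z}^m$, and let $P_B=\operatorname{conv}(B_1\cup\cdots\cup B_n)\subset\mathbb{R}^m$. For a polynomial $f$, $\operatorname{Newt}(f)$ is its Newton polytope, i.e. the convex hull of the exponents of the monomials appearing in $f$. Let $P_C=\operatorname{conv}(\operatorname{Newt}(\mathcal{T}_{a_1,\otimes})\cup\cdots\cup\operatorname{Newt}(\mathcal{T}_{a_n,\otimes})\cup\{0\})\subset\mathbb{R}^m$.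 Here $\operatorname{vol}$ is the Euclidean volume in $\mathbb{R}^m$. *)

theory Defs
  imports "HOL-Analysis.Analysis" "HOL-Library.Poly_Mapping" "HOL-Library.Extended_Nat"
begin

section \<open>Multivariate polynomials over the complex numbers\<close>

text \<open>
  A polynomial with variables indexed by \<open>'v\<close> is a finitely supported map from exponent vectors
  to coefficients; the convolution product of \<open>HOL-Library.Poly_Mapping\<close> is the product of
  polynomials.
\<close>

type_synonym 'v cpoly = "('v \<Rightarrow>\<^sub>0 nat) \<Rightarrow>\<^sub>0 complex"

definition Var :: "'v \<Rightarrow> 'v cpoly" where
  "Var i = Poly_Mapping.single (Poly_Mapping.single i 1) 1"

definition poly_eval :: "'v cpoly \<Rightarrow> ('v \<Rightarrow> complex) \<Rightarrow> complex" where
  "poly_eval p x =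
    (\<Sum>e\<in>Poly_Mapping.keys p. Poly_Mapping.lookup p e *
       (\<Prod>i\<in>Poly_Mapping.keys e. x i ^ Poly_Mapping.lookup e i))"

definition vars :: "'v cpoly \<Rightarrow> 'v set" where
  "vars p = (\<Union>e\<in>Poly_Mapping.keys p. Poly_Mapping.keys e)"

definition newton_polytope :: "('m::finite) cpoly \<Rightarrow> (real^'m) set" where
  "newton_polytope p =
    convex hull ((\<lambda>e. \<chi> i. real (Poly_Mapping.lookup e i)) ` Poly_Mapping.keys p)"


section \<open>Affine varieties: Zariski closure, dimension, degree\<close>

definition zariski_closed :: "(complex^'n) set \<Rightarrow> bool" where
  "zariski_closed Z \<longleftrightarrow> (\<exists>F :: 'n cpoly set. Z = {x. \<forall>p\<in>F. poly_eval p (($) x) = 0})"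

definition zariski_closure :: "(complex^'n) set \<Rightarrow> (complex^'n) set" where
  "zariski_closure S = zariski_closed hull S"

definition irreducible_variety :: "(complex^'n) set \<Rightarrow> bool" where
  "irreducible_variety Z \<longleftrightarrow> zariski_closed Z \<and> Z \<noteq> {} \<and>
    (\<forall>Z1 Z2. zariski_closed Z1 \<and> zariski_closed Z2 \<and> Z = Z1 \<union> Z2 \<longrightarrow> Z = Z1 \<or> Z = Z2)"

text \<open>
  Krull dimension of a Zariski closed set: the supremum of the lengths of strictly increasing
  chains of irreducible closed subsets. (The empty set gets dimension 0.)
\<close>

definition variety_dim :: "(complex^'n) set \<Rightarrow> enat" where
  "variety_dim X = Sup {enat k | k. \<exists>Z :: nat \<Rightarrow> (complex^'n) set.
     (\<forall>i\<le>k. irreducible_variety (Z i) \<and> Z i \<subseteq> X) \<and> (\<forall>i<k. Z i \<subset> Z (Suc i))}"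

text \<open>Here \<open>vec.subspace\<close> and \<open>vec.dim\<close> refer to complex scalars, unlike \<open>subspace\<close> and \<open>dim\<close>.\<close>

definition affine_linear_space :: "nat \<Rightarrow> (complex^'n) set \<Rightarrow> bool" where
  "affine_linear_space k L \<longleftrightarrow> (\<exists>p W. vec.subspace W \<and> vec.dim W = k \<and> L = (+) p ` W)"

text \<open>
  The solution set of \<open>d\<close> affine-linear equations. The coefficient of the \<open>j\<close>-th coordinate in
  the \<open>i\<close>-th equation is \<open>c (i, Some j)\<close> and its constant term is \<open>c (i, None)\<close>.
\<close>

definition linear_section :: "nat \<Rightarrow> (nat \<times> 'n option \<Rightarrow> complex) \<Rightarrow> (complex^'n) set" where
  "linear_section d c = {x. \<forall>i<d. (\<Sum>j\<in>UNIV. c (i, Some j) * x $ j) + c (i, None) = 0}"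

text \<open>
  A property of points of the affine space with coordinates indexed by \<open>V\<close> holds generically if it
  holds outside the zero set of some nonzero polynomial in these coordinates, i.e. on a nonempty
  Zariski open subset.
\<close>

definition generically :: "'v set \<Rightarrow> (('v \<Rightarrow> complex) \<Rightarrow> bool) \<Rightarrow> bool" where
  "generically V P \<longleftrightarrow>
    (\<exists>g :: 'v cpoly. g \<noteq> 0 \<and> vars g \<subseteq> V \<and> (\<forall>c. poly_eval g c \<noteq> 0 \<longrightarrow> P c))"

text \<open>
  A generic affine-linear space of codimension \<open>d = dim X\<close> is the one cut out by \<open>d\<close> equations
  with generic coefficients.
\<close>

definition variety_degree :: "(complex^'n) set \<Rightarrow> nat" where
  "variety_degree X = (let d = the_enat (variety_dim X) in
     THE N. generically ({..<d} \<times> UNIV) (\<lambda>c.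
       affine_linear_space (CARD('n) - d) (linear_section d c) \<and>
       finite (X \<inter> linear_section d c) \<and> card (X \<inter> linear_section d c) = N))"


section \<open>Tensor-product Chebyshev varieties\<close>

fun chebyshev_T :: "nat \<Rightarrow> 'a::comm_ring_1 \<Rightarrow> 'a" where
  "chebyshev_T 0 t = 1"
| "chebyshev_T (Suc 0) t = t"
| "chebyshev_T (Suc (Suc k)) t = 2 * t * chebyshev_T (Suc k) t - chebyshev_T k t"

definition tensor_chebyshev :: "nat^'n^'m \<Rightarrow> 'n \<Rightarrow> ('m::finite) cpoly" where
  "tensor_chebyshev A j = (\<Prod>i\<in>UNIV. chebyshev_T (A $ i $ j) (Var i))"

definition chebyshev_variety :: "nat^'n^'m \<Rightarrow> (complex^'n) set" where
  "chebyshev_variety A =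
    zariski_closure (range (\<lambda>t :: complex^'m. \<chi> j. poly_eval (tensor_chebyshev A j) (($) t)))"

definition P_B :: "nat^'n^'m \<Rightarrow> (real^'m) set" where
  "P_B A = convex hull (\<Union>j. {v. \<forall>i. v $ i \<in> {- real (A $ i $ j), real (A $ i $ j)}})"

definition P_C :: "nat^'n^'m \<Rightarrow> (real^'m) set" where
  "P_C A = convex hull ((\<Union>j. newton_polytope (tensor_chebyshev A j)) \<union> {0})"

end

theory Submission
  imports Defs "HOL-Computational_Algebra.Fundamental_Theorem_Algebra"
begin

text \<open>
  Let \<open>X\<close> be the closure of the image of a polynomial map \<open>T\<close> from \<open>\<complex>\<^sup>m\<close> to \<open>\<complex>\<^sup>n\<close>.
  The argument avoids root counts for sparse systems: it bounds the dimension of the space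
  of polynomials of degree at most \<open>k\<close> in the coordinates of \<open>T\<close> from both sides and lets \<open>k\<close> grow.

  \<^item> \<open>The degree is well defined.\<close> Adjoin to the \<open>m\<close> equations of a section one more linear form
    \<open>h\<close> with free coefficients. Unless generic sections are empty, a relation \<open>P\<close> of minimal degree
    \<open>r\<close> in \<open>h\<close> holds on all sections through points of \<open>X\<close>. Differentiating it by the coefficients
    of \<open>h\<close> gives \<open>x\<^sub>j * P' = - \<partial>P / \<partial>w\<^sub>j\<close> with \<open>P'\<close> the derivative by \<open>h\<close>, so a point of the
    section is recovered rationally from its value of \<open>h\<close>. As \<open>P\<close> is separable, a generic section
    corresponds to the \<open>r\<close> roots of \<open>P\<close>, and \<open>h\<close> separates its points
    (\<open>generic_section_count\<close>). That generic equations cut out an affine space of dimension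
    \<open>n - m\<close> requires \<open>m \<le> n\<close>, which follows from the hypothesis on the dimension, since a chain of
    \<open>k\<close> strict inclusions of irreducible varieties yields \<open>k\<close> algebraically independent
    polynomials (\<open>variety_dim_le_card\<close>).

  \<^item> \<open>The degree is at most \<open>m! vol(P\<^sub>C)\<close>.\<close> Write \<open>\<ell>\<^sub>1, \<dots>, \<ell>\<^sub>m\<close> for the linear forms of the
    equations. Since \<open>h\<close> takes \<open>r\<close> different values on generic fibres, the functions
    \<open>\<ell>\<^sup>\<alpha> h\<^sup>j\<close> with \<open>j < r\<close> are linearly independent
    (\<open>section_coordinates_independent\<close>). For \<open>\<bar>\<alpha>\<bar> \<le> k\<close> there are \<open>r * ((k + m) choose m)\<close> of them,
    and as polynomials in the parameters they are combinations of monomials with exponents in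
    \<open>(k + r) P\<^sub>C\<close>. Dividing by \<open>k\<^sup>m\<close> and letting \<open>k\<close> grow turns the comparison with the number of
    lattice points into \<open>r \<le> m! vol(P\<^sub>C)\<close> (\<open>section_count_le_volume\<close>).

  \<^item> \<open>Comparison of the two polytopes.\<close> The exponents of \<open>T\<^sub>a\<close> lie between \<open>0\<close> and \<open>a\<close>, so
    \<open>P\<^sub>C\<close> lies in the part of \<open>P\<^sub>B\<close> in the nonnegative orthant. The polytope \<open>P\<^sub>B\<close> is symmetric
    under sign changes of the coordinates, which makes this part a fraction \<open>2\<^sup>-\<^sup>m\<close> of its volume
    (\<open>volume_P_C_le\<close>).
\<close>

section \<open>Polynomial functions\<close>

text \<open>
  Over an infinite field polynomials may be replaced by the functions that they define. Substitution,
  partial evaluation and differentiation are then operations on functions.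
\<close>

inductive_set polyfuns :: "(('v \<Rightarrow> complex) \<Rightarrow> complex) set" where
  const: "(\<lambda>_. a) \<in> polyfuns"
| coord: "(\<lambda>x. x v) \<in> polyfuns"
| add: "f \<in> polyfuns \<Longrightarrow> g \<in> polyfuns \<Longrightarrow> (\<lambda>x. f x + g x) \<in> polyfuns"
| mult: "f \<in> polyfuns \<Longrightarrow> g \<in> polyfuns \<Longrightarrow> (\<lambda>x. f x * g x) \<in> polyfuns"

lemma polyfuns_uminus: "f \<in> polyfuns \<Longrightarrow> (\<lambda>x. - f x) \<in> polyfuns"
  using polyfuns.mult[OF polyfuns.const[of "-1"], of f] by simp

lemma polyfuns_diff: "f \<in> polyfuns \<Longrightarrow> g \<in> polyfuns \<Longrightarrow> (\<lambda>x. f x - g x) \<in> polyfuns"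
  using polyfuns.add[OF _ polyfuns_uminus, of f g] by simp

lemma polyfuns_sum: "(\<And>i. i \<in> I \<Longrightarrow> f i \<in> polyfuns) \<Longrightarrow> (\<lambda>x. \<Sum>i\<in>I. f i x) \<in> polyfuns"
proof (induction I rule: infinite_finite_induct)
  case (insert i I)
  then show ?case by (auto intro: polyfuns.add)
qed (auto intro: polyfuns.const)

lemma polyfuns_prod: "(\<And>i. i \<in> I \<Longrightarrow> f i \<in> polyfuns) \<Longrightarrow> (\<lambda>x. \<Prod>i\<in>I. f i x) \<in> polyfuns"
proof (induction I rule: infinite_finite_induct)
  case (insert i I)
  then show ?case by (auto intro: polyfuns.mult)
qed (auto intro: polyfuns.const)

lemma polyfuns_power: "f \<in> polyfuns \<Longrightarrow> (\<lambda>x. f x ^ k) \<in> polyfuns"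
  by (induction k) (auto intro: polyfuns.mult polyfuns.const)

lemmas polyfuns_intros = polyfuns.intros polyfuns_uminus polyfuns_diff polyfuns_sum polyfuns_prod
  polyfuns_power

lemma polyfuns_compose:
  assumes "f \<in> polyfuns" "\<And>v. (\<lambda>y. g v y) \<in> polyfuns"
  shows "(\<lambda>y. f (\<lambda>v. g v y)) \<in> polyfuns"
  using assms by (induction) (auto intro: polyfuns_intros)

lemma polyfuns_on_line:
  assumes "f \<in> polyfuns"
  shows "\<exists>p. \<forall>z. f (\<lambda>v. a v + z * d v) = poly p z"
  using assms
proof induction
  case (const b)
  show ?case by (rule exI[of _ "[:b:]"]) auto
next
  case (coord v)
  show ?case by (rule exI[of _ "[:a v, d v:]"]) (auto simp: mult.commute)
next
  case (add f g)
  then show ?case by (metis poly_add)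
next
  case (mult f g)
  then show ?case by (metis poly_mult)
qed

text \<open>
  Two points at which \<open>f\<close> and \<open>g\<close> do not vanish span a line, on which both are univariate
  polynomials; these have no zero divisors.
\<close>

lemma polyfuns_no_zero_divisors:
  assumes f: "f \<in> polyfuns" and g: "g \<in> polyfuns" and fg: "\<And>x. f x * g x = 0"
  shows "(\<forall>x. f x = 0) \<or> (\<forall>x. g x = 0)"
proof (rule ccontr)
  assume "\<not> ?thesis"
  then obtain a b where ab: "f a \<noteq> 0" "g b \<noteq> 0" by auto
  obtain p where p: "\<And>z. f (\<lambda>v. a v + z * (b v - a v)) = poly p z"
    using polyfuns_on_line[OF f, of a "\<lambda>v. b v - a v"] by blast
  obtain q where q: "\<And>z. g (\<lambda>v. a v + z * (b v - a v)) = poly q z"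
    using polyfuns_on_line[OF g, of a "\<lambda>v. b v - a v"] by blast
  have "poly (p * q) z = 0" for z
    using fg p q by (metis poly_mult)
  then have "p = 0 \<or> q = 0"
    using poly_all_0_iff_0 by (metis mult_eq_0_iff)
  moreover have "poly p 0 \<noteq> 0" using p[of 0] ab by simp
  moreover have "poly q 1 \<noteq> 0" using q[of 1] ab by simp
  ultimately show False by auto
qed

lemma polyfuns_poly_eval: "poly_eval p \<in> polyfuns"
  unfolding poly_eval_def[abs_def] by (intro polyfuns_intros)

lemma poly_eval_superset:
  assumes "finite K" "Poly_Mapping.keys p \<subseteq> K"
  shows "poly_eval p x = (\<Sum>e\<in>K. Poly_Mapping.lookup p e *
       (\<Prod>i\<in>Poly_Mapping.keys e. x i ^ Poly_Mapping.lookup e i))"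
  unfolding poly_eval_def using assms
  by (intro sum.mono_neutral_left) (auto simp: in_keys_iff)

lemma poly_eval_add: "poly_eval (p + q) x = poly_eval p x + poly_eval q x"
proof -
  let ?K = "Poly_Mapping.keys p \<union> Poly_Mapping.keys q"
  have "Poly_Mapping.keys (p + q) \<subseteq> ?K" by (rule keys_add)
  then show ?thesis
    by (simp add: poly_eval_superset[of ?K] lookup_add distrib_right sum.distrib)
qed

lemma poly_eval_zero: "poly_eval 0 x = 0"
  by (simp add: poly_eval_def)

lemma poly_eval_sum: "poly_eval (sum p I) x = (\<Sum>i\<in>I. poly_eval (p i) x)"
  by (induction I rule: infinite_finite_induct) (auto simp: poly_eval_add poly_eval_zero)

lemma poly_eval_single:
  "poly_eval (Poly_Mapping.single e a) x =
     a * (\<Prod>i\<in>Poly_Mapping.keys e. x i ^ Poly_Mapping.lookup e i)"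
  by (cases "a = 0") (auto simp: poly_eval_def)

lemma monomial_value_add:
  fixes x :: "'v \<Rightarrow> complex"
  shows "(\<Prod>i\<in>Poly_Mapping.keys (d + e). x i ^ Poly_Mapping.lookup (d + e) i) =
    (\<Prod>i\<in>Poly_Mapping.keys d. x i ^ Poly_Mapping.lookup d i) *
    (\<Prod>i\<in>Poly_Mapping.keys e. x i ^ Poly_Mapping.lookup e i)"
proof -
  let ?K = "Poly_Mapping.keys d \<union> Poly_Mapping.keys e"
  have ext: "(\<Prod>i\<in>Poly_Mapping.keys f. x i ^ Poly_Mapping.lookup f i) =
      (\<Prod>i\<in>?K. x i ^ Poly_Mapping.lookup f i)" if "Poly_Mapping.keys f \<subseteq> ?K" for f
    using that by (intro prod.mono_neutral_left) (auto simp: in_keys_iff)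
  show ?thesis
    by (subst (1 2 3) ext) (auto simp: keys_add lookup_add power_add prod.distrib dest: subsetD[OF keys_add])
qed

lemma poly_eval_mult: "poly_eval (p * q) x = poly_eval p x * poly_eval q x"
proof -
  have dec: "p = (\<Sum>e\<in>Poly_Mapping.keys p. Poly_Mapping.single e (Poly_Mapping.lookup p e))"
    for p :: "'a cpoly"
    by (rule poly_mapping_eqI)
      (auto simp: lookup_sum lookup_single when_def in_keys_iff)
  have "p * q = (\<Sum>d\<in>Poly_Mapping.keys p. \<Sum>e\<in>Poly_Mapping.keys q.
      Poly_Mapping.single (d + e) (Poly_Mapping.lookup p d * Poly_Mapping.lookup q e))"
    by (subst dec[of p], subst dec[of q]) (simp add: sum_product mult_single)
  then show ?thesis
    by (simp add: poly_eval_sum poly_eval_single monomial_value_add)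
      (simp add: poly_eval_def sum_product algebra_simps)
qed

lemma poly_eval_Var: "poly_eval (Var v) x = x v"
  by (simp add: Var_def poly_eval_single)

lemma vars_add: "vars (p + q) \<subseteq> vars p \<union> vars q"
  unfolding vars_def using keys_add[of p q] by auto

lemma vars_mult: "vars (p * q) \<subseteq> vars p \<union> vars q"
  unfolding vars_def using keys_mult[of p q] keys_add by fastforce

text \<open>
  Freezing the variables outside \<open>V\<close> turns a condition on many parameters into one that
  \<^const>\<open>generically\<close> accepts, where only variables from \<open>V\<close> may occur.
\<close>

lemma polyfuns_partial_eval_cpoly:
  assumes "f \<in> polyfuns"
  shows "\<exists>p. vars p \<subseteq> V \<and> (\<forall>x. poly_eval p x = f (\<lambda>v. if v \<in> V then x v else c v))"
  using assms
proof induction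
  case (const a)
  show ?case
    by (rule exI[of _ "Poly_Mapping.single 0 a"]) (auto simp: poly_eval_single vars_def)
next
  case (coord v)
  show ?case
  proof (cases "v \<in> V")
    case True
    then show ?thesis
      by (intro exI[of _ "Var v"]) (simp_all add: poly_eval_Var, simp add: vars_def Var_def)
  next
    case False
    then show ?thesis
      by (intro exI[of _ "Poly_Mapping.single 0 (c v)"]) (auto simp: poly_eval_single vars_def)
  qed
next
  case (add f g)
  then obtain p q where "vars p \<subseteq> V" "vars q \<subseteq> V"
    "\<And>x. poly_eval p x = f (\<lambda>v. if v \<in> V then x v else c v)"
    "\<And>x. poly_eval q x = g (\<lambda>v. if v \<in> V then x v else c v)" by blast
  then show ?case
    using vars_add[of p q] by (intro exI[of _ "p + q"]) (auto simp: poly_eval_add)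
next
  case (mult f g)
  then obtain p q where "vars p \<subseteq> V" "vars q \<subseteq> V"
    "\<And>x. poly_eval p x = f (\<lambda>v. if v \<in> V then x v else c v)"
    "\<And>x. poly_eval q x = g (\<lambda>v. if v \<in> V then x v else c v)" by blast
  then show ?case
    using vars_mult[of p q] by (intro exI[of _ "p * q"]) (auto simp: poly_eval_mult)
qed

text \<open>
  Induction on the variables: regard the sum as a polynomial in one variable, all of whose
  coefficients vanish. The exponents are given by a map \<open>\<phi>\<close> so that they may carry data outside
  \<open>V\<close>, or be lists.
\<close>

lemma monomials_independent:
  fixes c :: "'e \<Rightarrow> complex" and \<phi> :: "'e \<Rightarrow> 'v \<Rightarrow> nat"
  assumes "finite V" "finite E"
    and "\<And>e e'. e \<in> E \<Longrightarrow> e' \<in> E \<Longrightarrow> (\<And>v. v \<in> V \<Longrightarrow> \<phi> e v = \<phi> e' v) \<Longrightarrow> e = e'"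
    and "\<And>x. (\<Sum>e\<in>E. c e * (\<Prod>v\<in>V. x v ^ \<phi> e v)) = 0" and "e \<in> E"
  shows "c e = 0"
  using assms
proof (induction V arbitrary: E rule: finite_induct)
  case empty
  then have "E = {e}" by auto
  then show ?case using empty.prems(3) by simp
next
  case (insert v V)
  let ?E = "{e' \<in> E. \<phi> e' v = \<phi> e v}"
  show ?case
  proof (rule insert.IH)
    fix x :: "'v \<Rightarrow> complex"
    define q where "q = (\<Sum>e\<in>E. monom (c e * (\<Prod>v\<in>V. x v ^ \<phi> e v)) (\<phi> e v))"
    have "poly q z = 0" for z
    proof -
      have "(\<Prod>w\<in>insert v V. (x(v := z)) w ^ \<phi> e w) = z ^ \<phi> e v * (\<Prod>w\<in>V. x w ^ \<phi> e w)" for e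
      proof -
        have "(\<Prod>w\<in>V. (x(v := z)) w ^ \<phi> e w) = (\<Prod>w\<in>V. x w ^ \<phi> e w)"
          using insert.hyps by (intro prod.cong) auto
        then show ?thesis using insert.hyps by simp
      qed
      then have "poly q z = (\<Sum>e\<in>E. c e * (\<Prod>w\<in>insert v V. (x(v := z)) w ^ \<phi> e w))"
        unfolding q_def poly_sum poly_monom by (intro sum.cong) (auto simp: algebra_simps)
      then show ?thesis using insert.prems(3) by metis
    qed
    then have "q = 0" using poly_all_0_iff_0 by blast
    then have "coeff q (\<phi> e v) = 0" by simp
    then have "(\<Sum>e'\<in>E. if \<phi> e' v = \<phi> e v then c e' * (\<Prod>w\<in>V. x w ^ \<phi> e' w) else 0) = 0"
      unfolding q_def coeff_sum coeff_monom .
    then show "(\<Sum>e'\<in>?E. c e' * (\<Prod>w\<in>V. x w ^ \<phi> e' w)) = 0"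
      using insert.prems(1) by (simp add: sum.inter_filter)
  next
    fix d d' assume "d \<in> ?E" "d' \<in> ?E" "\<And>w. w \<in> V \<Longrightarrow> \<phi> d w = \<phi> d' w"
    then show "d = d'" by (intro insert.prems(2)) auto
  qed (use insert.prems in auto)
qed

lemma poly_eval_nonzero:
  fixes g :: "'v cpoly"
  assumes "g \<noteq> 0"
  shows "\<exists>x. poly_eval g x \<noteq> 0"
proof (rule ccontr)
  assume "\<not> ?thesis"
  then have 0: "poly_eval g x = 0" for x by auto
  define V where "V = vars g"
  have V: "finite V" by (auto simp: V_def vars_def)
  have sub: "Poly_Mapping.keys e \<subseteq> V" if "e \<in> Poly_Mapping.keys g" for e
    using that by (auto simp: V_def vars_def)
  obtain e where e: "e \<in> Poly_Mapping.keys g" using assms keys_eq_empty by (metis all_not_in_conv poly_mapping_eqI in_keys_iff lookup_zero)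
  have "Poly_Mapping.lookup g e = 0"
  proof (rule monomials_independent[OF V, of "Poly_Mapping.keys g" Poly_Mapping.lookup])
    fix d e assume de: "d \<in> Poly_Mapping.keys g" "e \<in> Poly_Mapping.keys g"
      and eq: "\<And>v. v \<in> V \<Longrightarrow> Poly_Mapping.lookup d v = Poly_Mapping.lookup e v"
    show "d = e"
    proof (rule poly_mapping_eqI)
      fix v show "Poly_Mapping.lookup d v = Poly_Mapping.lookup e v"
        using eq[of v] sub[OF de(1)] sub[OF de(2)] by (metis in_keys_iff subsetD)
    qed
  next
    fix x :: "'v \<Rightarrow> complex"
    have "(\<Sum>e\<in>Poly_Mapping.keys g. Poly_Mapping.lookup g e * (\<Prod>v\<in>V. x v ^ Poly_Mapping.lookup e v))
      = poly_eval g x"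
      unfolding poly_eval_def
      by (intro sum.cong refl arg_cong2[where f = "(*)"] prod.mono_neutral_right)
        (auto simp: V sub in_keys_iff dest: sub)
    then show "(\<Sum>e\<in>Poly_Mapping.keys g. Poly_Mapping.lookup g e * (\<Prod>v\<in>V. x v ^ Poly_Mapping.lookup e v)) = 0"
      using 0 by simp
  qed (use e in auto)
  then show False using e by auto
qed

text \<open>
  Two generic conditions hold simultaneously somewhere, because the product of the two polynomials
  is not identically zero; so the generic number of points of a section is unique.
\<close>

lemma generically_unique:
  assumes "generically V P" "generically V Q"
  shows "\<exists>c. P c \<and> Q c"
proof -
  obtain g h where gh: "g \<noteq> 0" "h \<noteq> 0" "\<And>c. poly_eval g c \<noteq> 0 \<Longrightarrow> P c" "\<And>c. poly_eval h c \<noteq> 0 \<Longrightarrow> Q c"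
    using assms unfolding generically_def by blast
  have "\<not> (\<forall>c. poly_eval g c * poly_eval h c = 0)"
    using polyfuns_no_zero_divisors[OF polyfuns_poly_eval[of g] polyfuns_poly_eval[of h]]
      poly_eval_nonzero gh by blast
  then show ?thesis using gh(3,4) by auto
qed

lemma genericallyI:
  assumes f: "f \<in> polyfuns" "f c0 \<noteq> 0"
    and P: "\<And>c. f (\<lambda>v. if v \<in> V then c v else c0 v) \<noteq> 0 \<Longrightarrow> P c"
  shows "generically V P"
proof -
  obtain p where p: "vars p \<subseteq> V" "\<And>x. poly_eval p x = f (\<lambda>v. if v \<in> V then x v else c0 v)"
    using polyfuns_partial_eval_cpoly[OF f(1)] by blast
  have "poly_eval p c0 \<noteq> 0" using p(2)[of c0] f(2) by simp
  then have "p \<noteq> 0" using poly_eval_zero by metis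
  then show ?thesis unfolding generically_def using p P by metis
qed

section \<open>Monomial spans and algebraic dependence\<close>

lemma homogeneous_system_nontrivial_solution:
  fixes A :: "'i \<Rightarrow> 'j \<Rightarrow> complex"
  assumes "finite J" "finite I" "card J < card I"
  shows "\<exists>c. (\<exists>i\<in>I. c i \<noteq> 0) \<and> (\<forall>j\<in>J. (\<Sum>i\<in>I. c i * A i j) = 0)"
  using assms
proof (induction J arbitrary: I A rule: finite_induct)
  case empty
  then have "I \<noteq> {}" by auto
  then show ?case by (intro exI[of _ "\<lambda>_. 1"]) auto
next
  case (insert j J)
  show ?case
  proof (cases "\<forall>i\<in>I. A i j = 0")
    case True
    obtain c where "\<exists>i\<in>I. c i \<noteq> 0" "\<forall>j\<in>J. (\<Sum>i\<in>I. c i * A i j) = 0"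
      using insert.IH[of I A] insert.prems insert.hyps by auto
    with True show ?thesis by (intro exI[of _ c]) auto
  next
    case False
    then obtain k where k: "k \<in> I" "A k j \<noteq> 0" by auto
    define I' where "I' = I - {k}"
    have I': "finite I'" "k \<notin> I'" "I = insert k I'" using k insert.prems by (auto simp: I'_def)
    have "card J < card I'" using insert.prems insert.hyps I' by simp
    then obtain c where c: "\<exists>i\<in>I'. c i \<noteq> 0"
        "\<forall>l\<in>J. (\<Sum>i\<in>I'. c i * (A i l - A i j / A k j * A k l)) = 0"
      using insert.IH[of I' "\<lambda>i l. A i l - A i j / A k j * A k l"] I' by auto
    define d where "d = c(k := - (\<Sum>i\<in>I'. c i * A i j) / A k j)"
    have sum_d: "(\<Sum>i\<in>I. d i * A i l) = d k * A k l + (\<Sum>i\<in>I'. c i * A i l)" for l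
    proof -
      have "(\<Sum>i\<in>I'. d i * A i l) = (\<Sum>i\<in>I'. c i * A i l)"
        using I' by (intro sum.cong) (auto simp: d_def)
      then show ?thesis using I' by simp
    qed
    have "(\<Sum>i\<in>I. d i * A i l) = 0" if "l \<in> insert j J" for l
    proof (cases "l = j")
      case True
      then show ?thesis unfolding sum_d using k by (simp add: d_def)
    next
      case False
      then have "(\<Sum>i\<in>I'. c i * (A i l - A i j / A k j * A k l)) = 0" using c that by auto
      then have "(\<Sum>i\<in>I'. c i * A i l) = (\<Sum>i\<in>I'. c i * A i j) / A k j * A k l"
        by (simp add: right_diff_distrib sum_subtractf sum_distrib_right sum_divide_distrib mult.assoc)
      then show ?thesis unfolding sum_d by (simp add: d_def)
    qed
    moreover have "\<exists>i\<in>I. d i \<noteq> 0" using c(1) I' by (auto simp: d_def)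
    ultimately show ?thesis by blast
  qed
qed

definition monomial_span :: "('a::finite \<Rightarrow> nat) set \<Rightarrow> (('a \<Rightarrow> complex) \<Rightarrow> complex) set" where
  "monomial_span S = {f. \<exists>a. \<forall>x. f x = (\<Sum>e\<in>S. a e * (\<Prod>i\<in>UNIV. x i ^ e i))}"

lemma monomial_spanI:
  "(\<And>x. f x = (\<Sum>e\<in>S. a e * (\<Prod>i\<in>UNIV. x i ^ e i))) \<Longrightarrow> f \<in> monomial_span S"
  unfolding monomial_span_def by blast

lemma monomial_spanE:
  assumes "f \<in> monomial_span S"
  obtains a where "\<And>x. f x = (\<Sum>e\<in>S. a e * (\<Prod>i\<in>UNIV. x i ^ e i))"
  using assms unfolding monomial_span_def by blast

lemma monomial_span_mono:
  assumes "f \<in> monomial_span S" "S \<subseteq> S'" "finite S'"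
  shows "f \<in> monomial_span S'"
proof -
  obtain a where a: "\<And>x. f x = (\<Sum>e\<in>S. a e * (\<Prod>i\<in>UNIV. x i ^ e i))"
    using assms(1) by (rule monomial_spanE) (rule that)
  show ?thesis
  proof (rule monomial_spanI)
    fix x
    have "f x = (\<Sum>e\<in>S. (if e \<in> S then a e else 0) * (\<Prod>i\<in>UNIV. x i ^ e i))"
      unfolding a by (intro sum.cong) auto
    also have "\<dots> = (\<Sum>e\<in>S'. (if e \<in> S then a e else 0) * (\<Prod>i\<in>UNIV. x i ^ e i))"
      using assms by (intro sum.mono_neutral_left) auto
    finally show "f x = \<dots>" .
  qed
qed

lemma monomial_span_add:
  assumes "f \<in> monomial_span S" "g \<in> monomial_span S"
  shows "(\<lambda>x. f x + g x) \<in> monomial_span S"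
proof -
  obtain a where "\<And>x. f x = (\<Sum>e\<in>S. a e * (\<Prod>i\<in>UNIV. x i ^ e i))"
    using assms(1) by (rule monomial_spanE) (rule that)
  moreover obtain b where "\<And>x. g x = (\<Sum>e\<in>S. b e * (\<Prod>i\<in>UNIV. x i ^ e i))"
    using assms(2) by (rule monomial_spanE) (rule that)
  ultimately show ?thesis
    by (intro monomial_spanI[where a = "\<lambda>e. a e + b e"]) (simp add: distrib_right sum.distrib)
qed

lemma monomial_span_cmult:
  assumes "f \<in> monomial_span S"
  shows "(\<lambda>x. c * f x) \<in> monomial_span S"
proof -
  obtain a where "\<And>x. f x = (\<Sum>e\<in>S. a e * (\<Prod>i\<in>UNIV. x i ^ e i))"
    using assms by (rule monomial_spanE) (rule that)
  then show ?thesis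
    by (intro monomial_spanI[where a = "\<lambda>e. c * a e"]) (simp add: sum_distrib_left mult.assoc)
qed

lemma monomial_span_zero: "(\<lambda>x. 0) \<in> monomial_span S"
  by (rule monomial_spanI[where a = "\<lambda>_. 0"]) simp

lemma monomial_span_sum:
  "(\<And>i. i \<in> I \<Longrightarrow> f i \<in> monomial_span S) \<Longrightarrow> (\<lambda>x. \<Sum>i\<in>I. f i x) \<in> monomial_span S"
  by (induction I rule: infinite_finite_induct) (auto intro: monomial_span_zero monomial_span_add)

lemma monomial_span_mult:
  assumes "f \<in> monomial_span S" "g \<in> monomial_span S'"
    and "\<And>d e. d \<in> S \<Longrightarrow> e \<in> S' \<Longrightarrow> (\<lambda>i. d i + e i) \<in> S''" and "finite S" "finite S'" "finite S''"
  shows "(\<lambda>x. f x * g x) \<in> monomial_span S''"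
proof -
  obtain a where a: "\<And>x. f x = (\<Sum>e\<in>S. a e * (\<Prod>i\<in>UNIV. x i ^ e i))"
    using assms(1) by (rule monomial_spanE) (rule that)
  obtain b where b: "\<And>x. g x = (\<Sum>e\<in>S'. b e * (\<Prod>i\<in>UNIV. x i ^ e i))"
    using assms(2) by (rule monomial_spanE) (rule that)
  have "(\<lambda>x. f x * g x) = (\<lambda>x. \<Sum>d\<in>S. \<Sum>e\<in>S'. (a d * b e) * (\<Prod>i\<in>UNIV. x i ^ (d i + e i)))"
    by (simp add: a b sum_product power_add prod.distrib algebra_simps)
  moreover have "(\<lambda>x. c * (\<Prod>i\<in>UNIV. x i ^ (s i))) \<in> monomial_span S''" if "s \<in> S''" for c s
  proof (rule monomial_spanI)
    fix x :: "'a \<Rightarrow> complex"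
    have "(\<Sum>e\<in>S''. (if e = s then c else 0) * (\<Prod>i\<in>UNIV. x i ^ e i)) =
       (\<Sum>e\<in>S''. if e = s then c * (\<Prod>i\<in>UNIV. x i ^ e i) else 0)"
      by (intro sum.cong) auto
    then show "c * (\<Prod>i\<in>UNIV. x i ^ (s i)) =
      (\<Sum>e\<in>S''. (if e = s then c else 0) * (\<Prod>i\<in>UNIV. x i ^ e i))"
      using that assms(6) by (simp add: sum.delta)
  qed
  ultimately show ?thesis using assms(3) by (simp add: monomial_span_sum)
qed

lemma monomial_span_linear_dependence:
  assumes "finite S" "finite I" "card S < card I" "\<And>i. i \<in> I \<Longrightarrow> g i \<in> monomial_span S"
  shows "\<exists>c. (\<exists>i\<in>I. c i \<noteq> 0) \<and> (\<forall>x. (\<Sum>i\<in>I. c i * g i x) = 0)"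
proof -
  obtain A where A: "\<And>i x. i \<in> I \<Longrightarrow> g i x = (\<Sum>e\<in>S. A i e * (\<Prod>k\<in>UNIV. x k ^ e k))"
    using bchoice[of I "\<lambda>i a. \<forall>x. g i x = (\<Sum>e\<in>S. a e * (\<Prod>k\<in>UNIV. x k ^ e k))"] assms(4)
    unfolding monomial_span_def by blast
  obtain c where c: "\<exists>i\<in>I. c i \<noteq> 0" "\<forall>e\<in>S. (\<Sum>i\<in>I. c i * A i e) = 0"
    using homogeneous_system_nontrivial_solution[OF assms(1-3), of A] by blast
  have "(\<Sum>i\<in>I. c i * g i x) = 0" for x
  proof -
    have "(\<Sum>i\<in>I. c i * g i x) = (\<Sum>i\<in>I. \<Sum>e\<in>S. c i * A i e * (\<Prod>k\<in>UNIV. x k ^ e k))"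
      using A by (simp add: sum_distrib_left mult.assoc)
    also have "\<dots> = (\<Sum>e\<in>S. (\<Sum>i\<in>I. c i * A i e) * (\<Prod>k\<in>UNIV. x k ^ e k))"
      by (subst sum.swap) (simp add: sum_distrib_right)
    finally show ?thesis using c by simp
  qed
  with c(1) show ?thesis by blast
qed

abbreviation degree_box :: "nat \<Rightarrow> ('a::finite \<Rightarrow> nat) set" where
  "degree_box k \<equiv> {e. \<forall>i. e i \<le> k}"

lemma degree_box: "finite (degree_box k :: ('a::finite \<Rightarrow> nat) set)"
  "card (degree_box k :: ('a::finite \<Rightarrow> nat) set) = Suc k ^ CARD('a)"
proof -
  have *: "degree_box k = PiE (UNIV :: 'a set) (\<lambda>_. {..k})" by (auto simp: PiE_def Pi_def)
  show "finite (degree_box k :: ('a::finite \<Rightarrow> nat) set)" unfolding * by (intro finite_PiE) auto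
  show "card (degree_box k :: ('a::finite \<Rightarrow> nat) set) = Suc k ^ CARD('a)"
    unfolding * by (simp add: card_PiE)
qed

lemma monomial_span_box_mono:
  "f \<in> monomial_span (degree_box k) \<Longrightarrow> k \<le> l \<Longrightarrow> f \<in> monomial_span (degree_box l)"
  by (erule monomial_span_mono) (auto simp: degree_box intro: order_trans)

lemma monomial_span_box_mult:
  "f \<in> monomial_span (degree_box k) \<Longrightarrow> g \<in> monomial_span (degree_box l) \<Longrightarrow>
    (\<lambda>x. f x * g x) \<in> monomial_span (degree_box (k + l))"
  by (erule (1) monomial_span_mult) (auto simp: degree_box intro: add_mono)

lemma monomial_span_box_one: "(\<lambda>x. 1) \<in> monomial_span (degree_box 0)"
proof (rule monomial_spanI)
  have *: "(degree_box 0 :: ('a \<Rightarrow> nat) set) = {\<lambda>_. 0}" by (auto simp: fun_eq_iff)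
  show "1 = (\<Sum>e\<in>degree_box 0. 1 * (\<Prod>i\<in>UNIV. x i ^ e i))" for x :: "'a \<Rightarrow> complex"
    unfolding * by simp
qed

lemma monomial_span_box_power:
  "f \<in> monomial_span (degree_box k) \<Longrightarrow> (\<lambda>x. f x ^ n) \<in> monomial_span (degree_box (n * k))"
proof (induction n)
  case 0
  show ?case using monomial_span_box_one by simp
next
  case (Suc n)
  then show ?case using monomial_span_box_mult[of f k "\<lambda>x. f x ^ n" "n * k"] by simp
qed

lemma monomial_span_box_prod:
  assumes "finite I" "\<And>i. i \<in> I \<Longrightarrow> f i \<in> monomial_span (degree_box k)"
  shows "(\<lambda>x. \<Prod>i\<in>I. f i x) \<in> monomial_span (degree_box (card I * k))"
  using assms
proof (induction I rule: finite_induct)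
  case empty
  show ?case using monomial_span_box_one by simp
next
  case (insert i I)
  then show ?case using monomial_span_box_mult[of "f i" k "\<lambda>x. \<Prod>i\<in>I. f i x" "card I * k"] by simp
qed

lemma polyfuns_monomial_span_box:
  assumes "f \<in> polyfuns"
  shows "\<exists>k. f \<in> monomial_span (degree_box k)"
  using assms
proof induction
  case (const a)
  show ?case using monomial_span_cmult[OF monomial_span_box_one, of a] by (intro exI[of _ 0]) simp
next
  case (coord v)
  let ?e = "\<lambda>i. if i = v then 1 else 0 :: nat"
  have v: "x v = (\<Sum>e\<in>{?e}. 1 * (\<Prod>i\<in>UNIV. x i ^ e i))" for x :: "'a \<Rightarrow> complex"
  proof -
    have "(\<Prod>i\<in>UNIV. x i ^ ?e i) = (\<Prod>i\<in>UNIV. if i = v then x i else 1)"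
      by (intro prod.cong) auto
    then show ?thesis by simp
  qed
  have "(\<lambda>x. x v) \<in> monomial_span {?e}" by (rule monomial_spanI, rule v)
  then have "(\<lambda>x. x v) \<in> monomial_span (degree_box 1)"
    by (rule monomial_span_mono) (auto simp: degree_box)
  then show ?case by blast
next
  case (add f g)
  then obtain k l where "f \<in> monomial_span (degree_box k)" "g \<in> monomial_span (degree_box l)" by blast
  then have "f \<in> monomial_span (degree_box (max k l))" "g \<in> monomial_span (degree_box (max k l))"
    by (auto intro: monomial_span_box_mono)
  then show ?case using monomial_span_add by blast
next
  case (mult f g)
  then show ?case using monomial_span_box_mult by blast
qed

text \<open>
  More polynomials than variables are algebraically dependent. The products of the \<open>f b\<close> with
  exponents below \<open>K\<close> number \<open>K ^ card B\<close>, but they lie in a space whose dimension grows only like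
  \<open>K ^ CARD('a)\<close>.
\<close>

lemma algebraic_dependence:
  fixes f :: "'b \<Rightarrow> ('a::finite \<Rightarrow> complex) \<Rightarrow> complex"
  assumes B: "finite B" "CARD('a) < card B" and f: "\<And>b. b \<in> B \<Longrightarrow> f b \<in> polyfuns"
  shows "\<exists>P\<in>polyfuns. (\<exists>y. P y \<noteq> 0) \<and> (\<forall>y y'. (\<forall>b\<in>B. y b = y' b) \<longrightarrow> P y = P y') \<and>
           (\<forall>x. P (\<lambda>b. f b x) = 0)"
proof -
  obtain k where k: "\<And>b. b \<in> B \<Longrightarrow> f b \<in> monomial_span (degree_box (k b))"
    using bchoice[of B "\<lambda>b k. f b \<in> monomial_span (degree_box k)"] polyfuns_monomial_span_box[OF f] by blast
  define D where "D = (\<Sum>b\<in>B. k b)"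
  have D: "f b \<in> monomial_span (degree_box D)" if b: "b \<in> B" for b
    using monomial_span_box_mono[OF k[OF b]] member_le_sum[OF b _ B(1), of k] by (simp add: D_def)
  define C where "C = card B * D + 1"
  define K where "K = C ^ CARD('a) + 1"
  define E where "E = PiE B (\<lambda>_. {..<K})"
  have E: "finite E" "card E = K ^ card B"
    using B by (auto simp: E_def card_PiE intro: finite_PiE)
  define g where "g = (\<lambda>e x. \<Prod>b\<in>B. f b x ^ e b)"
  define L where "L = card B * (K * D)"
  have g: "g e \<in> monomial_span (degree_box L)" if "e \<in> E" for e
    unfolding g_def L_def
  proof (intro monomial_span_box_prod B)
    fix b assume b: "b \<in> B"
    then have "e b \<le> K" using that PiE_mem[of e B "\<lambda>_. {..<K}" b] by (simp add: E_def)
    then have "e b * D \<le> K * D" by (rule mult_right_mono) simp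
    then show "(\<lambda>x. f b x ^ e b) \<in> monomial_span (degree_box (K * D))"
      by (rule monomial_span_box_mono[OF monomial_span_box_power[OF D[OF b]]])
  qed
  \<comment> \<open>The box containing the exponents of the products has at most \<open>(C * K) ^ CARD('a)\<close> points, and \<open>K\<close> exceeds \<open>C ^ CARD('a)\<close>.\<close>
  have less: "card (degree_box L :: ('a \<Rightarrow> nat) set) < card E"
  proof -
    have "Suc L \<le> C * K" by (simp add: L_def C_def K_def algebra_simps)
    then have "Suc L ^ CARD('a) \<le> (C * K) ^ CARD('a)" by (rule power_mono) auto
    also have "\<dots> = C ^ CARD('a) * K ^ CARD('a)" by (rule power_mult_distrib)
    also have "\<dots> < K * K ^ CARD('a)" by (simp add: K_def)
    also have "\<dots> = K ^ Suc CARD('a)" by simp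
    also have "\<dots> \<le> K ^ card B" using B by (intro power_increasing) (auto simp: K_def)
    finally show ?thesis using E by (simp add: degree_box)
  qed
  obtain c where c: "\<exists>e\<in>E. c e \<noteq> 0" "\<And>x. (\<Sum>e\<in>E. c e * g e x) = 0"
    using monomial_span_linear_dependence[where g = g, OF degree_box(1) E(1) less g] by auto
  define P where "P = (\<lambda>y. \<Sum>e\<in>E. c e * (\<Prod>b\<in>B. y b ^ e b))"
  have "\<exists>y. P y \<noteq> 0"
  proof (rule ccontr)
    assume "\<not> ?thesis"
    then have 0: "P y = 0" for y by auto
    obtain e where "e \<in> E" "c e \<noteq> 0" using c by auto
    moreover have "c e = 0" if "e \<in> E" for e
    proof (rule monomials_independent[OF B(1) E(1), of "\<lambda>e. e"])
      fix d e assume "d \<in> E" "e \<in> E" "\<And>b. b \<in> B \<Longrightarrow> d b = e b"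
      then show "d = e" unfolding E_def by (metis PiE_ext)
    qed (use 0 that in \<open>auto simp: P_def\<close>)
    ultimately show False by auto
  qed
  moreover have "P \<in> polyfuns" unfolding P_def by (intro polyfuns_intros)
  moreover have "P y = P y'" if "\<forall>b\<in>B. y b = y' b" for y y'
    using that by (auto simp: P_def intro!: sum.cong prod.cong)
  moreover have "P (\<lambda>b. f b x) = 0" for x using c(2) by (simp add: P_def g_def)
  ultimately show ?thesis by blast
qed

section \<open>The domain of polynomial functions\<close>

text \<open>
  As a type of class \<open>idom\<close>, polynomial functions can serve as coefficients of univariate
  polynomials, which makes pseudo-division available.
\<close>

typedef 'v polyfun = "polyfuns :: (('v \<Rightarrow> complex) \<Rightarrow> complex) set"
  morphisms pf_eval Polyfun
  using polyfuns.const by blast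

setup_lifting type_definition_polyfun

instantiation polyfun :: (type) comm_ring_1
begin
lift_definition zero_polyfun :: "'a polyfun" is "\<lambda>_. 0" by (rule polyfuns.const)
lift_definition one_polyfun :: "'a polyfun" is "\<lambda>_. 1" by (rule polyfuns.const)
lift_definition plus_polyfun :: "'a polyfun \<Rightarrow> 'a polyfun \<Rightarrow> 'a polyfun" is "\<lambda>f g x. f x + g x"
  by (rule polyfuns.add)
lift_definition times_polyfun :: "'a polyfun \<Rightarrow> 'a polyfun \<Rightarrow> 'a polyfun" is "\<lambda>f g x. f x * g x"
  by (rule polyfuns.mult)
lift_definition uminus_polyfun :: "'a polyfun \<Rightarrow> 'a polyfun" is "\<lambda>f x. - f x"
  by (rule polyfuns_uminus)
lift_definition minus_polyfun :: "'a polyfun \<Rightarrow> 'a polyfun \<Rightarrow> 'a polyfun" is "\<lambda>f g x. f x - g x"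
  by (rule polyfuns_diff)
instance
  by standard (transfer, simp add: algebra_simps fun_eq_iff)+
end

instance polyfun :: (type) idom
proof
  fix f g :: "'a polyfun"
  assume "f \<noteq> 0" "g \<noteq> 0"
  then show "f * g \<noteq> 0"
    by transfer (metis (mono_tags, lifting) ext polyfuns_no_zero_divisors)
qed

lift_definition pf_coord :: "'v \<Rightarrow> 'v polyfun" is "\<lambda>v x. x v" by (rule polyfuns.coord)
lift_definition pf_const :: "complex \<Rightarrow> 'v polyfun" is "\<lambda>a _. a" by (rule polyfuns.const)

lemma pf_eval_simps [simp]:
  "pf_eval 0 c = 0" "pf_eval 1 c = 1" "pf_eval (f + g) c = pf_eval f c + pf_eval g c"
  "pf_eval (f * g) c = pf_eval f c * pf_eval g c" "pf_eval (- f) c = - pf_eval f c"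
  "pf_eval (f - g) c = pf_eval f c - pf_eval g c" "pf_eval (pf_coord v) c = c v"
  "pf_eval (pf_const a) c = a"
  by (transfer, simp)+

lemma pf_eval_of_nat [simp]: "pf_eval (of_nat n) c = of_nat n"
  by (induction n) auto

lemma pf_eval_sum [simp]: "pf_eval (\<Sum>i\<in>I. f i) c = (\<Sum>i\<in>I. pf_eval (f i) c)"
  by (induction I rule: infinite_finite_induct) auto

lemma pf_eval_power [simp]: "pf_eval (f ^ n) c = pf_eval f c ^ n"
  by (induction n) auto

lemma polyfun_nonzero_iff: "f \<noteq> 0 \<longleftrightarrow> (\<exists>c. pf_eval f c \<noteq> 0)"
  by transfer (auto simp: fun_eq_iff)

lemma polyfun_zeroI: "(\<And>c. pf_eval f c = 0) \<Longrightarrow> f = 0"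
  using polyfun_nonzero_iff by blast

definition specialize :: "'v polyfun poly \<Rightarrow> ('v \<Rightarrow> complex) \<Rightarrow> complex poly" where
  "specialize P c = map_poly (\<lambda>f. pf_eval f c) P"

lemma coeff_specialize [simp]: "coeff (specialize P c) i = pf_eval (coeff P i) c"
  unfolding specialize_def by (simp add: coeff_map_poly)

lemma specialize_simps [simp]:
  "specialize 0 c = 0" "specialize 1 c = 1" "specialize (P + Q) c = specialize P c + specialize Q c"
  "specialize (P - Q) c = specialize P c - specialize Q c" "specialize (- P) c = - specialize P c"
  "specialize (P * Q) c = specialize P c * specialize Q c"
  "specialize (smult a P) c = smult (pf_eval a c) (specialize P c)"
  "specialize (pCons a P) c = pCons (pf_eval a c) (specialize P c)"
  "specialize (pderiv P) c = pderiv (specialize P c)"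
  by (rule poly_eqI; simp add: coeff_mult coeff_pCons coeff_pderiv split: nat.split)+

lemma specialize_sum [simp]: "specialize (\<Sum>i\<in>I. P i) c = (\<Sum>i\<in>I. specialize (P i) c)"
  by (induction I rule: infinite_finite_induct) auto

lemma specialize_power [simp]: "specialize (P ^ n) c = specialize P c ^ n"
  by (induction n) auto

lemma polyfuns_poly_specialize:
  assumes "\<And>v. (\<lambda>y. g y v) \<in> polyfuns" "h \<in> polyfuns"
  shows "(\<lambda>y. poly (specialize P (g y)) (h y)) \<in> polyfuns"
proof (induction P)
  case 0
  then show ?case by (auto intro: polyfuns_intros)
next
  case (pCons a P)
  have "(\<lambda>y. pf_eval a (\<lambda>v. g y v)) \<in> polyfuns"
    using polyfuns_compose[OF pf_eval assms(1), of a] .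
  then show ?case using pCons assms(2) by (auto intro!: polyfuns_intros)
qed

text \<open>
  A polynomial function is a univariate polynomial in any one of its variables. If
  \<open>F\<close> is not identically zero, neither is \<open>P\<close>, as \<open>\<eta>\<close> may be \<open>c v\<close>.
\<close>

lemma polyfuns_split_coord:
  assumes "F \<in> polyfuns"
  shows "\<exists>P. \<forall>c \<eta>. F (c(v := \<eta>)) = poly (specialize P c) \<eta>"
  using assms
proof (induction rule: polyfuns.induct)
  case (const a)
  show ?case by (rule exI[of _ "[:pf_const a:]"]) simp
next
  case (coord w)
  show ?case
    by (cases "w = v", rule exI[of _ "[:0, 1:]"], simp, rule exI[of _ "[:pf_coord w:]"], simp)
next
  case (add f g)
  then obtain P Q where "\<And>c \<eta>. f (c(v := \<eta>)) = poly (specialize P c) \<eta>"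
    "\<And>c \<eta>. g (c(v := \<eta>)) = poly (specialize Q c) \<eta>" by blast
  then show ?case by (intro exI[of _ "P + Q"]) (simp add: fun_upd_def)
next
  case (mult f g)
  then obtain P Q where "\<And>c \<eta>. f (c(v := \<eta>)) = poly (specialize P c) \<eta>"
    "\<And>c \<eta>. g (c(v := \<eta>)) = poly (specialize Q c) \<eta>" by blast
  then show ?case by (intro exI[of _ "P * Q"]) (simp add: fun_upd_def)
qed

instance polyfun :: (type) ring_char_0
proof
  show "inj (of_nat :: nat \<Rightarrow> 'a polyfun)"
  proof (rule injI)
    fix i j assume "(of_nat i :: 'a polyfun) = of_nat j"
    then have "pf_eval (of_nat i :: 'a polyfun) (\<lambda>_. 0) = pf_eval (of_nat j) (\<lambda>_. 0)" by simp
    then show "i = j" by simp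
  qed
qed

text \<open>
  Chain rule for a polynomial whose coefficients depend on the variable \<open>v\<close> and whose argument
  moves along \<open>a + z * s\<close>: the polynomial \<open>Q\<close> is the coefficientwise partial derivative by \<open>v\<close>.
\<close>

lemma specialize_has_field_derivative:
  "\<exists>Q. \<forall>c a s z. ((\<lambda>z. poly (specialize P (c(v := z))) (a + z * s)) has_field_derivative
      poly (specialize Q (c(v := z))) (a + z * s) +
      s * poly (specialize (pderiv P) (c(v := z))) (a + z * s)) (at z)"
proof (induction P)
  case 0
  show ?case by (rule exI[of _ 0]) auto
next
  case (pCons b P)
  have "\<exists>b'. \<forall>c z. ((\<lambda>z. f (c(v := z))) has_field_derivative pf_eval b' (c(v := z))) (at z)"
    if "f \<in> polyfuns" for f
    using that
  proof (induction rule: polyfuns.induct)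
    case (const a)
    show ?case by (rule exI[of _ 0]) auto
  next
    case (coord w)
    show ?case
      by (cases "w = v", rule exI[of _ 1], simp, rule exI[of _ 0], simp)
  next
    case (add f g)
    then obtain f' g' where
      "\<And>c z. ((\<lambda>z. f (c(v := z))) has_field_derivative pf_eval f' (c(v := z))) (at z)"
      "\<And>c z. ((\<lambda>z. g (c(v := z))) has_field_derivative pf_eval g' (c(v := z))) (at z)" by blast
    then show ?case by (intro exI[of _ "f' + g'"]) (auto simp del: fun_upd_apply intro!: DERIV_add)
  next
    case (mult f g)
    then obtain f' g' where
      f': "\<And>c z. ((\<lambda>z. f (c(v := z))) has_field_derivative pf_eval f' (c(v := z))) (at z)" and
      g': "\<And>c z. ((\<lambda>z. g (c(v := z))) has_field_derivative pf_eval g' (c(v := z))) (at z)" by blast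
    show ?case
      by (intro exI[of _ "f' * Polyfun g + Polyfun f * g'"] allI)
        (rule derivative_eq_intros f' g' refl | simp add: Polyfun_inverse mult fun_upd_def)+
  qed
  from this[OF pf_eval, of b] obtain b'
    where b': "\<And>c z. ((\<lambda>z. pf_eval b (c(v := z))) has_field_derivative pf_eval b' (c(v := z))) (at z)"
    by blast
  obtain Q where Q: "\<And>c a s z. ((\<lambda>z. poly (specialize P (c(v := z))) (a + z * s)) has_field_derivative
      poly (specialize Q (c(v := z))) (a + z * s) +
      s * poly (specialize (pderiv P) (c(v := z))) (a + z * s)) (at z)"
    using pCons.IH by blast
  show ?case
  proof (intro exI[of _ "pCons b' Q"] allI)
    fix c a s z
    show "((\<lambda>z. poly (specialize (pCons b P) (c(v := z))) (a + z * s)) has_field_derivative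
      poly (specialize (pCons b' Q) (c(v := z))) (a + z * s) +
      s * poly (specialize (pderiv (pCons b P)) (c(v := z))) (a + z * s)) (at z)"
      unfolding specialize_simps poly_pCons
    proof (rule DERIV_cong[OF DERIV_add[OF b' DERIV_mult[OF _ Q]]])
      show "((\<lambda>z. a + z * s) has_field_derivative s) (at z)"
        by (auto intro!: derivative_eq_intros)
    qed (simp add: pderiv_pCons algebra_simps)
  qed
qed

section \<open>Chains of irreducible varieties\<close>

lemma polyfuns_cpoly:
  assumes "f \<in> polyfuns"
  shows "\<exists>p. \<forall>x. poly_eval p x = f x"
  using polyfuns_partial_eval_cpoly[OF assms, of UNIV] by auto

lemma zariski_closed_Int_zeros:
  assumes "zariski_closed Z" "f \<in> polyfuns"
  shows "zariski_closed (Z \<inter> {x. f (($) x) = 0})"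
proof -
  obtain F where F: "Z = {x. \<forall>p\<in>F. poly_eval p (($) x) = 0}"
    using assms(1) unfolding zariski_closed_def by blast
  obtain p where "\<And>x. poly_eval p x = f x" using polyfuns_cpoly[OF assms(2)] by blast
  then show ?thesis unfolding zariski_closed_def F by (intro exI[of _ "insert p F"]) auto
qed

lemma irreducible_variety_no_zero_divisors:
  assumes Z: "irreducible_variety Z" and fg: "f \<in> polyfuns" "g \<in> polyfuns"
    and 0: "\<And>x. x \<in> Z \<Longrightarrow> f (($) x) * g (($) x) = 0"
  shows "(\<forall>x\<in>Z. f (($) x) = 0) \<or> (\<forall>x\<in>Z. g (($) x) = 0)"
proof -
  have "Z = (Z \<inter> {x. f (($) x) = 0}) \<union> (Z \<inter> {x. g (($) x) = 0})" using 0 by auto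
  moreover have "zariski_closed (Z \<inter> {x. f (($) x) = 0})" "zariski_closed (Z \<inter> {x. g (($) x) = 0})"
    using Z fg by (auto intro!: zariski_closed_Int_zeros simp: irreducible_variety_def)
  ultimately have "Z = Z \<inter> {x. f (($) x) = 0} \<or> Z = Z \<inter> {x. g (($) x) = 0}"
    using Z unfolding irreducible_variety_def by blast
  then show ?thesis by blast
qed

lemma zariski_closed_psubset_witness:
  assumes "zariski_closed Z" "Z \<subset> Z'"
  shows "\<exists>f\<in>polyfuns. (\<forall>x\<in>Z. f (($) x) = 0) \<and> (\<exists>x\<in>Z'. f (($) x) \<noteq> 0)"
proof -
  obtain F where F: "Z = {x. \<forall>p\<in>F. poly_eval p (($) x) = 0}"
    using assms(1) unfolding zariski_closed_def by blast
  obtain x where "x \<in> Z'" "x \<notin> Z" using assms(2) by blast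
  then obtain p where "p \<in> F" "poly_eval p (($) x) \<noteq> 0" unfolding F by blast
  then show ?thesis using \<open>x \<in> Z'\<close> polyfuns_poly_eval[of p] F by blast
qed

text \<open>
  A relation \<open>F\<close> among the \<open>f i\<close> on \<open>Z (Suc k)\<close>, written as a polynomial in the last function
  \<open>f k\<close>, has a constant coefficient that is a relation on \<open>Z k\<close>, where \<open>f k\<close> vanishes; so this
  coefficient is zero by induction. Since \<open>f k\<close> is not zero on the irreducible \<open>Z (Suc k)\<close>, it can
  then be cancelled, and all coefficients vanish one after the other. Variables from \<open>k\<close> on are free
  parameters \<open>y\<close>, which keeps the type of \<open>F\<close> fixed during the induction.
\<close>

lemma chain_algebraically_independent:
  fixes Z :: "nat \<Rightarrow> (complex^'n) set" and f :: "nat \<Rightarrow> ('n \<Rightarrow> complex) \<Rightarrow> complex"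
  assumes irr: "\<And>i. i \<le> k \<Longrightarrow> irreducible_variety (Z i)"
    and f: "\<And>i. i < k \<Longrightarrow> f i \<in> polyfuns"
    and mono: "\<And>i. i < k \<Longrightarrow> Z i \<subseteq> Z (Suc i)"
    and van: "\<And>i x. i < k \<Longrightarrow> x \<in> Z i \<Longrightarrow> f i (($) x) = 0"
    and nonvan: "\<And>i. i < k \<Longrightarrow> \<exists>x\<in>Z (Suc i). f i (($) x) \<noteq> 0"
    and F: "F \<in> polyfuns" "\<And>x y. x \<in> Z k \<Longrightarrow> F (\<lambda>i. if i < k then f i (($) x) else y i) = 0"
  shows "F y = 0"
  using assms
proof (induction k arbitrary: F y)
  case 0
  then obtain x where "x \<in> Z 0" by (auto simp: irreducible_variety_def)
  then show ?case using 0 by simp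
next
  case (Suc k)
  define ext where "ext = (\<lambda>y x i. if i < k then f i (($) x) else y i)"
  have ext_poly: "(\<lambda>x. if i < k then f i x else y i) \<in> polyfuns" for i y
    using Suc.prems(2)[of i] by (cases "i < k") (auto intro: polyfuns.const)
  obtain P where P: "\<And>c \<eta>. F (c(k := \<eta>)) = poly (specialize P c) \<eta>"
    using polyfuns_split_coord[OF Suc.prems(6)] by blast
  have "poly (specialize P (ext y x)) (f k (($) x)) = 0" if "x \<in> Z (Suc k)" for x y
  proof -
    have "(ext y x)(k := f k (($) x)) = (\<lambda>i. if i < Suc k then f i (($) x) else y i)"
      by (auto simp: ext_def fun_eq_iff less_Suc_eq)
    then show ?thesis using Suc.prems(7)[OF that, of y] P by metis
  qed
  then have "P = 0"
  proof (induction P)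
    case (pCons a P)
    have "pf_eval a y = 0" for y
    proof (rule Suc.IH[of "pf_eval a"])
      fix x y assume x: "x \<in> Z k"
      have "x \<in> Z (Suc k)" "f k (($) x) = 0" using x Suc.prems(3,4)[of k] by auto
      then show "pf_eval a (\<lambda>i. if i < k then f i (($) x) else y i) = 0"
        using pCons.prems[of x y] by (simp add: ext_def)
    qed (use Suc.prems pf_eval in auto)
    then have "a = 0" by (rule polyfun_zeroI)
    moreover have "P = 0"
    proof (rule pCons.IH)
      fix x y assume x: "x \<in> Z (Suc k)"
      have "(\<forall>x\<in>Z (Suc k). f k (($) x) = 0) \<or>
         (\<forall>x\<in>Z (Suc k). poly (specialize P (ext y x)) (f k (($) x)) = 0)"
        unfolding ext_def
      proof (rule irreducible_variety_no_zero_divisors[of _ "f k"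
            "\<lambda>z. poly (specialize P (\<lambda>i. if i < k then f i z else y i)) (f k z)"])
        show "(\<lambda>z. poly (specialize P (\<lambda>i. if i < k then f i z else y i)) (f k z)) \<in> polyfuns"
          using Suc.prems(2)[of k] ext_poly by (intro polyfuns_poly_specialize) auto
        fix x assume "x \<in> Z (Suc k)"
        from pCons.prems[OF this, of y] \<open>a = 0\<close>
        show "f k (($) x) * poly (specialize P (\<lambda>i. if i < k then f i (($) x) else y i)) (f k (($) x)) = 0"
          by (simp add: ext_def)
      qed (use Suc.prems(1)[of "Suc k"] Suc.prems(2)[of k] in auto)
      then show "poly (specialize P (ext y x)) (f k (($) x)) = 0"
        using x Suc.prems(5)[of k] by auto
    qed
    ultimately show ?case by simp
  qed simp
  then show ?case using P[of y "y k"] by simp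
qed

lemma irreducible_chain_length_le:
  fixes Z :: "nat \<Rightarrow> (complex^'n) set"
  assumes irr: "\<And>i. i \<le> k \<Longrightarrow> irreducible_variety (Z i)"
    and mono: "\<And>i. i < k \<Longrightarrow> Z i \<subset> Z (Suc i)"
  shows "k \<le> CARD('n)"
proof (rule ccontr)
  assume "\<not> ?thesis"
  then have k: "CARD('n) < card {..<k}" by simp
  have "\<exists>f\<in>polyfuns. (\<forall>x\<in>Z i. f (($) x) = 0) \<and> (\<exists>x\<in>Z (Suc i). f (($) x) \<noteq> 0)"
    if "i < k" for i
    using zariski_closed_psubset_witness[of "Z i"] irr[of i] mono[OF that] that
    by (auto simp: irreducible_variety_def)
  then obtain f where f: "\<And>i. i < k \<Longrightarrow> f i \<in> polyfuns" "\<And>i x. i < k \<Longrightarrow> x \<in> Z i \<Longrightarrow> f i (($) x) = 0"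
      "\<And>i. i < k \<Longrightarrow> \<exists>x\<in>Z (Suc i). f i (($) x) \<noteq> 0"
    by metis
  obtain F y where F: "F \<in> polyfuns" "F y \<noteq> 0"
      "\<And>y y'. (\<forall>b\<in>{..<k}. y b = y' b) \<Longrightarrow> F y = F y'" "\<And>x. F (\<lambda>b. f b x) = 0"
    using algebraic_dependence[OF _ k, of f] f(1) by auto
  have "F y = 0"
  proof (rule chain_algebraically_independent[of k Z f F])
    fix x y assume "x \<in> Z k"
    show "F (\<lambda>i. if i < k then f i (($) x) else y i) = 0"
      using F(3)[of "\<lambda>i. if i < k then f i (($) x) else y i" "\<lambda>i. f i (($) x)"] F(4)[of "($) x"] by simp
  qed (use irr mono f F in auto)
  with F show False by simp
qed

lemma variety_dim_le_card:
  fixes X :: "(complex^'n) set"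
  assumes "variety_dim X = enat m"
  shows "m \<le> CARD('n)"
proof -
  have "variety_dim X \<le> enat CARD('n)"
    unfolding variety_dim_def
  proof (rule Sup_least)
    fix l assume "l \<in> {enat k |k. \<exists>Z :: nat \<Rightarrow> (complex^'n) set.
      (\<forall>i\<le>k. irreducible_variety (Z i) \<and> Z i \<subseteq> X) \<and> (\<forall>i<k. Z i \<subset> Z (Suc i))}"
    then obtain k and Z :: "nat \<Rightarrow> (complex^'n) set" where "l = enat k"
      "\<And>i. i \<le> k \<Longrightarrow> irreducible_variety (Z i)" "\<And>i. i < k \<Longrightarrow> Z i \<subset> Z (Suc i)"
      by blast
    then show "l \<le> enat CARD('n)" using irreducible_chain_length_le[of k Z] by auto
  qed
  then show ?thesis using assms by simp
qed

section \<open>Linear sections of a parametrized variety\<close>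

lemma zariski_closure_vanish:
  assumes "f \<in> polyfuns" "\<And>x. x \<in> S \<Longrightarrow> f (($) x) = 0" "x \<in> zariski_closure S"
  shows "f (($) x) = 0"
proof -
  have "zariski_closed (UNIV :: (complex^'a) set)"
    unfolding zariski_closed_def by (intro exI[of _ "{}"]) auto
  then have "zariski_closed {x. f (($) x) = 0}"
    using zariski_closed_Int_zeros[OF _ assms(1)] by fastforce
  then have "zariski_closure S \<subseteq> {x. f (($) x) = 0}"
    unfolding zariski_closure_def using assms(2) by (intro hull_minimal) auto
  then show ?thesis using assms(3) by blast
qed

lemma zariski_closureI:
  assumes "\<And>f. f \<in> polyfuns \<Longrightarrow> (\<And>x. x \<in> S \<Longrightarrow> f (($) x) = 0) \<Longrightarrow> f (($) x) = 0"
  shows "x \<in> zariski_closure S"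
  unfolding zariski_closure_def hull_def
proof (clarify)
  fix Z assume Z: "zariski_closed Z" "S \<subseteq> Z"
  then obtain F where F: "Z = {x. \<forall>p\<in>F. poly_eval p (($) x) = 0}"
    unfolding zariski_closed_def by blast
  then show "x \<in> Z" using Z assms[OF polyfuns_poly_eval] by blast
qed

lemma card_roots_rsquarefree:
  fixes q :: "complex poly"
  assumes "q \<noteq> 0" "\<And>z. poly q z = 0 \<Longrightarrow> poly (pderiv q) z \<noteq> 0"
  shows "card {z. poly q z = 0} = degree q"
proof -
  have "rsquarefree q" using assms by (auto simp: rsquarefree_roots)
  have fin: "finite {z. poly q z = 0}" using assms(1) by (rule poly_roots_finite)
  have "degree q = degree (smult (lead_coeff q) (\<Prod>z | poly q z = 0. [:- z, 1:]))"
    using complex_poly_decompose_rsquarefree[OF \<open>rsquarefree q\<close>] by simp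
  also have "\<dots> = (\<Sum>z | poly q z = 0. degree [:- z, 1:])"
    using assms(1) by (simp add: degree_prod_eq_sum_degree)
  also have "\<dots> = card {z. poly q z = 0}" by simp
  finally show ?thesis by (rule sym)
qed

text \<open>
  For a section by \<open>d\<close> equations, rows below \<open>d\<close> of the coefficients belong to the equations,
  and row \<open>d\<close> provides an auxiliary linear form.
\<close>

definition linear_form :: "nat \<Rightarrow> (nat \<times> 'n::finite option \<Rightarrow> complex) \<Rightarrow> ('n \<Rightarrow> complex) \<Rightarrow> complex" where
  "linear_form i c x = (\<Sum>j\<in>UNIV. c (i, Some j) * x j)"

text \<open>
  The constant terms of the first \<open>d\<close> equations are changed such that the section passes through
  \<open>x\<close>.
\<close>

definition translate_through ::
  "nat \<Rightarrow> (nat \<times> 'n::finite option \<Rightarrow> complex) \<Rightarrow> ('n \<Rightarrow> complex) \<Rightarrow> nat \<times> 'n option \<Rightarrow> complex" where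
  "translate_through d c x =
     (\<lambda>(i, k). if k = None \<and> i < d then - linear_form i c x else c (i, k))"

lemma translate_through_simps [simp]:
  "translate_through d c x (i, Some j) = c (i, Some j)"
  "translate_through d c x (i, None) = (if i < d then - linear_form i c x else c (i, None))"
  by (auto simp: translate_through_def)

lemma translate_through_section:
  assumes "x \<in> linear_section d c"
  shows "translate_through d c (($) x) = c"
proof -
  have "- linear_form i c (($) x) = c (i, None)" if "i < d" for i
    using assms that by (auto simp: linear_section_def linear_form_def add_eq_0_iff)
  then show ?thesis by (auto simp: translate_through_def fun_eq_iff)
qed

lemma polyfuns_linear_form:
  assumes "\<And>v. (\<lambda>y. c y v) \<in> polyfuns" "\<And>j. (\<lambda>y. x y j) \<in> polyfuns"
  shows "(\<lambda>y. linear_form i (c y) (x y)) \<in> polyfuns"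
  unfolding linear_form_def by (intro polyfuns_intros assms)

lemma polyfuns_translate_through:
  assumes "\<And>v. (\<lambda>y. c y v) \<in> polyfuns" "\<And>j. (\<lambda>y. x y j) \<in> polyfuns"
  shows "(\<lambda>y. translate_through d (c y) (x y) v) \<in> polyfuns"
proof (cases v)
  case (Pair i k)
  have "(\<lambda>y. - linear_form i (c y) (x y)) \<in> polyfuns"
    by (intro polyfuns_uminus polyfuns_linear_form assms)
  with Pair show ?thesis
    using assms(1)[of "(i, k)"] by (cases k; cases "i < d") simp_all
qed

locale parametrized_variety =
  fixes T :: "'n::finite \<Rightarrow> ('m::finite \<Rightarrow> complex) \<Rightarrow> complex" and d :: nat
  assumes T: "T j \<in> polyfuns" and d: "d = CARD('m)"
begin

abbreviation pt :: "('m \<Rightarrow> complex) \<Rightarrow> 'n \<Rightarrow> complex" where "pt t \<equiv> \<lambda>j. T j t"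

definition X :: "(complex^'n) set" where
  "X = zariski_closure (range (\<lambda>t :: complex^'m. \<chi> j. T j (($) t)))"

lemma X_vanish:
  assumes "f \<in> polyfuns" "\<And>t. f (pt t) = 0" "x \<in> X"
  shows "f (($) x) = 0"
  by (rule zariski_closure_vanish[OF assms(1) _ assms(3)[unfolded X_def]])
    (auto simp: vec_lambda_inverse assms(2))

lemma X_memI:
  assumes "\<And>f. f \<in> polyfuns \<Longrightarrow> (\<And>t. f (pt t) = 0) \<Longrightarrow> f (($) x) = 0"
  shows "x \<in> X"
  unfolding X_def
proof (rule zariski_closureI)
  fix f :: "('n \<Rightarrow> complex) \<Rightarrow> complex"
  assume f: "f \<in> polyfuns"
    and 0: "\<And>x. x \<in> range (\<lambda>t :: complex^'m. \<chi> j. T j (($) t)) \<Longrightarrow> f (($) x) = 0"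
  have "f (pt t) = 0" for t
    using 0[OF rangeI[of _ "\<chi> i. t i"]] by (simp add: vec_lambda_inverse)
  then show "f (($) x) = 0" using assms f by blast
qed

text \<open>
  The univariate polynomial \<open>P\<close> has the coefficients of a section as parameters, and its argument
  stands for the value of the auxiliary linear form. Membership in this prime ideal means that \<open>P\<close>
  is a relation between the equations of a section, the auxiliary form, and its value at a point of
  the variety through which the section passes.
\<close>

definition vanishes :: "(nat \<times> 'n option) polyfun poly \<Rightarrow> bool" where
  "vanishes P \<longleftrightarrow> (\<forall>c t. poly (specialize P (translate_through d c (pt t)))
      (linear_form d c (pt t)) = 0)"

lemma vanishes_on_X:
  assumes "vanishes P" "x \<in> X"
  shows "poly (specialize P (translate_through d c (($) x))) (linear_form d c (($) x)) = 0"
proof (rule X_vanish[OF _ _ assms(2)])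
  show "(\<lambda>x. poly (specialize P (translate_through d c x)) (linear_form d c x)) \<in> polyfuns"
    by (intro polyfuns_poly_specialize polyfuns_translate_through polyfuns_linear_form polyfuns_intros)
qed (use assms(1) in \<open>auto simp: vanishes_def\<close>)

lemma vanishes_prime:
  assumes "vanishes (P * Q)"
  shows "vanishes P \<or> vanishes Q"
proof -
  define \<Phi> where "\<Phi> = (\<lambda>P (y :: (nat \<times> 'n option) + 'm \<Rightarrow> complex).
    poly (specialize P (translate_through d (\<lambda>v. y (Inl v)) (pt (\<lambda>i. y (Inr i)))))
      (linear_form d (\<lambda>v. y (Inl v)) (pt (\<lambda>i. y (Inr i)))))"
  have pT: "(\<lambda>y :: (nat \<times> 'n option) + 'm \<Rightarrow> complex. T j (\<lambda>i. y (Inr i))) \<in> polyfuns" for j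
    by (rule polyfuns_compose[OF T]) (rule polyfuns.coord)
  have "\<Phi> R \<in> polyfuns" for R
    unfolding \<Phi>_def
    by (intro polyfuns_poly_specialize polyfuns_translate_through polyfuns_linear_form pT polyfuns.coord)
  moreover have "\<Phi> P y * \<Phi> Q y = 0" for y
    using assms by (auto simp: \<Phi>_def vanishes_def)
  ultimately have "(\<forall>y. \<Phi> P y = 0) \<or> (\<forall>y. \<Phi> Q y = 0)"
    by (intro polyfuns_no_zero_divisors)
  moreover have "vanishes R" if "\<forall>y. \<Phi> R y = 0" for R
    unfolding vanishes_def
  proof (intro allI)
    fix c t
    show "poly (specialize R (translate_through d c (pt t))) (linear_form d c (pt t)) = 0"
      using that[rule_format, of "case_sum c t"] by (simp add: \<Phi>_def)
  qed
  ultimately show ?thesis by blast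
qed

text \<open>
  The coefficients of \<open>d + 1\<close> linear forms together with the \<open>d\<close> parameters of a point determine
  all entries of the matrix of \<open>d + 1\<close> affine forms that vanish at that point. These are fewer
  quantities than entries, so the entries satisfy a polynomial relation.
\<close>

lemma ex_vanishing: "\<exists>P. P \<noteq> 0 \<and> vanishes P"
proof -
  have "card {..d} = CARD('m option)" by (simp add: d)
  then obtain \<rho> where \<rho>: "bij_betw \<rho> {..d} (UNIV :: 'm option set)"
    by (metis finite_atMost finite finite_same_card_bij)
  define B where "B = {..d} \<times> (UNIV :: 'n option set)"
  define f :: "nat \<times> 'n option \<Rightarrow> (('m option \<times> 'n) + 'm \<Rightarrow> complex) \<Rightarrow> complex" where
    "f = (\<lambda>(i, k) y. case k of Some j \<Rightarrow> y (Inl (\<rho> i, j))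
       | None \<Rightarrow> (if i < d then -1 else 1) * (\<Sum>j\<in>UNIV. y (Inl (\<rho> i, j)) * T j (\<lambda>i. y (Inr i))))"
  have pT: "(\<lambda>y :: ('m option \<times> 'n) + 'm \<Rightarrow> complex. T j (\<lambda>i. y (Inr i))) \<in> polyfuns" for j
    by (rule polyfuns_compose[OF T]) (rule polyfuns.coord)
  have f: "f b \<in> polyfuns" for b
  proof -
    obtain i k where b: "b = (i, k)" by (cases b)
    show ?thesis
    proof (cases k)
      case None
      have "f b = (\<lambda>y. (if i < d then -1 else 1) *
          (\<Sum>j\<in>UNIV. y (Inl (\<rho> i, j)) * T j (\<lambda>i. y (Inr i))))"
        by (auto simp: f_def b None)
      then show ?thesis by (simp only:) (intro polyfuns_intros pT)
    next
      case (Some j)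
      then show ?thesis by (simp add: f_def b polyfuns.coord)
    qed
  qed
  have fin: "finite B" by (simp add: B_def)
  have card: "CARD(('m option \<times> 'n) + 'm) < card B"
    by (simp add: B_def d card_cartesian_product)
  obtain F y where F: "F \<in> polyfuns" "F y \<noteq> 0"
      "\<And>y y'. (\<forall>b\<in>B. y b = y' b) \<Longrightarrow> F y = F y'" "\<And>x. F (\<lambda>b. f b x) = 0"
    using algebraic_dependence[OF fin card, of f] f by auto
  obtain P where P: "\<And>c \<eta>. F (c((d, None) := \<eta>)) = poly (specialize P c) \<eta>"
    using polyfuns_split_coord[OF F(1)] by blast
  have "P \<noteq> 0"
  proof
    assume "P = 0"
    then have "F y = 0" using P[of y "y (d, None)"] by simp
    then show False using F by simp
  qed
  moreover have "vanishes P"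
    unfolding vanishes_def
  proof (intro allI)
    fix c t
    define y :: "('m option \<times> 'n) + 'm \<Rightarrow> complex" where
      "y = case_sum (\<lambda>(r, j). c (the_inv_into {..d} \<rho> r, Some j)) t"
    have y: "y (Inl (\<rho> i, j)) = c (i, Some j)" if "i \<le> d" for i j
      using \<rho> that by (simp add: y_def the_inv_into_f_f bij_betw_imp_inj_on)
    have "F ((translate_through d c (pt t))((d, None) := linear_form d c (pt t))) = F (\<lambda>b. f b y)"
    proof (rule F(3), rule ballI)
      fix b assume "b \<in> B"
      then obtain i k where b: "b = (i, k)" "i \<le> d" by (auto simp: B_def)
      have yt: "(\<lambda>i. y (Inr i)) = t" by (simp add: y_def)
      show "((translate_through d c (pt t))((d, None) := linear_form d c (pt t))) b = f b y"
      proof (cases k)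
        case None
        have "i < d \<or> i = d" using b(2) by auto
        then show ?thesis
          by (elim disjE) (auto simp: f_def y b(1) yt None linear_form_def sum_negf)
      next
        case (Some j)
        then show ?thesis using b by (simp add: f_def y)
      qed
    qed
    then show "poly (specialize P (translate_through d c (pt t))) (linear_form d c (pt t)) = 0"
      using F(4) P by simp
  qed
  ultimately show ?thesis by blast
qed

end

context parametrized_variety
begin

text \<open>
  The polynomial \<open>\<delta>\<close> plays the role of the discriminant. A nonzero element \<open>D\<close> of least degree in
  the ideal generated by \<open>P\<close> and its derivative divides \<open>P\<close> up to a factor \<open>a\<close> of degree \<open>0\<close>. By primality one
  of \<open>D\<close> and the quotient \<open>Q\<close> is again a relation. It cannot be \<open>D\<close>, whose degree is below that of
  \<open>P\<close>, and if it is \<open>Q\<close>, then \<open>D\<close> is constant.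
\<close>

lemma separable_minimal_vanishing:
  assumes indep: "\<And>a. (\<And>c t. pf_eval a (translate_through d c (pt t)) = 0) \<Longrightarrow> a = 0"
  shows "\<exists>P \<delta> U V. P \<noteq> 0 \<and> vanishes P \<and> (\<forall>Q. vanishes Q \<longrightarrow> Q \<noteq> 0 \<longrightarrow> degree P \<le> degree Q) \<and>
    \<delta> \<noteq> 0 \<and> [:\<delta>:] = U * P + V * pderiv P"
proof -
  obtain P where P: "P \<noteq> 0" "vanishes P" and "\<forall>Q. Q \<noteq> 0 \<and> vanishes Q \<longrightarrow> degree P \<le> degree Q"
    using ex_has_least_nat[of "\<lambda>P. P \<noteq> 0 \<and> vanishes P" _ degree] ex_vanishing by blast
  then have min: "degree P \<le> degree Q" if "vanishes Q" "Q \<noteq> 0" for Q using that by blast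
  have deg: "degree P \<noteq> 0"
  proof
    assume "degree P = 0"
    then obtain a where a: "P = [:a:]" by (rule degree_eq_zeroE)
    then have "pf_eval a (translate_through d c (pt t)) = 0" for c t
      using P(2) by (simp add: vanishes_def)
    then have "a = 0" by (rule indep)
    with P a show False by simp
  qed
  define J where "J = {U * P + V * pderiv P | U V. True}"
  have J_mult: "R * D \<in> J" if "D \<in> J" for R D
  proof -
    obtain U V where "D = U * P + V * pderiv P" using \<open>D \<in> J\<close> by (auto simp: J_def)
    then have "R * D = (R * U) * P + (R * V) * pderiv P" by (simp add: algebra_simps)
    then show ?thesis unfolding J_def by blast
  qed
  have J_diff: "D - E \<in> J" if "D \<in> J" "E \<in> J" for D E
  proof -
    obtain U V where "D = U * P + V * pderiv P" using \<open>D \<in> J\<close> by (auto simp: J_def)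
    moreover obtain U' V' where "E = U' * P + V' * pderiv P" using \<open>E \<in> J\<close> by (auto simp: J_def)
    ultimately have "D - E = (U - U') * P + (V - V') * pderiv P" by (simp add: algebra_simps)
    then show ?thesis unfolding J_def by blast
  qed
  have P_J: "P \<in> J" unfolding J_def by (rule CollectI, rule exI[of _ 1], rule exI[of _ 0]) simp
  have P'_J: "pderiv P \<in> J" unfolding J_def by (rule CollectI, rule exI[of _ 0], rule exI[of _ 1]) simp
  obtain D where D: "D \<noteq> 0" "D \<in> J" and "\<forall>E. E \<noteq> 0 \<and> E \<in> J \<longrightarrow> degree D \<le> degree E"
    using ex_has_least_nat[of "\<lambda>E. E \<noteq> 0 \<and> E \<in> J" P degree] P_J P by blast
  then have D_min: "degree D \<le> degree E" if "E \<in> J" "E \<noteq> 0" for E using that by blast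
  obtain a Q where aQ: "a \<noteq> 0" "smult a P = D * Q + pseudo_mod P D"
    using pseudo_mod(1)[OF D(1), of P] by blast
  have "pseudo_mod P D = [:a:] * P - Q * D" using aQ(2) by (simp add: algebra_simps)
  then have "pseudo_mod P D \<in> J"
    by (simp only:) (intro J_diff J_mult P_J D)
  then have "pseudo_mod P D = 0" using pseudo_mod(2)[OF D(1), of P] D_min by force
  then have DQ: "D * Q = smult a P" using aQ by simp
  have "vanishes (D * Q)" unfolding DQ using P(2) by (simp add: vanishes_def)
  moreover have "\<not> vanishes D"
  proof
    assume "vanishes D"
    then have "degree P \<le> degree D" using min D by blast
    also have "\<dots> \<le> degree (pderiv P)"
      using D_min[OF P'_J] deg by (simp add: pderiv_eq_0_iff)
    finally show False using deg by (simp add: degree_pderiv)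
  qed
  ultimately have "vanishes Q" using vanishes_prime by blast
  moreover have "Q \<noteq> 0" using DQ aQ P by auto
  ultimately have "degree P \<le> degree Q" by (rule min)
  moreover have "degree D + degree Q = degree P"
    using arg_cong[OF DQ, of degree] aQ(1) D(1) \<open>Q \<noteq> 0\<close> by (simp add: degree_mult_eq)
  ultimately have "degree D = 0" by simp
  then obtain \<delta> where "D = [:\<delta>:]" by (rule degree_eq_zeroE)
  then have "\<delta> \<noteq> 0" "[:\<delta>:] \<in> J" using D by auto
  then show ?thesis using P min unfolding J_def by blast
qed

text \<open>
  Differentiating the relation by the coefficient \<open>(d, Some j)\<close> of the auxiliary form: the value of
  the form changes at the rate \<open>T j t\<close>, while the translated constant terms of the other rows do not
  change. This expresses the coordinate \<open>T j t\<close> rationally by the value of the form.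
\<close>

lemma vanishes_gradient:
  assumes "vanishes P"
  shows "\<exists>Q. \<forall>c t. poly (specialize Q (translate_through d c (pt t))) (linear_form d c (pt t)) =
    - (T j t * poly (specialize (pderiv P) (translate_through d c (pt t))) (linear_form d c (pt t)))"
proof -
  let ?v = "(d, Some j)"
  obtain Q where Q: "\<And>c a s z. ((\<lambda>z. poly (specialize P (c(?v := z))) (a + z * s)) has_field_derivative
      poly (specialize Q (c(?v := z))) (a + z * s) +
      s * poly (specialize (pderiv P) (c(?v := z))) (a + z * s)) (at z)"
    using specialize_has_field_derivative[of P ?v] by blast
  show ?thesis
  proof (intro exI[of _ Q] allI)
    fix c t
    define b where "b = translate_through d c (pt t)"
    \<comment> \<open>The contribution of the other coefficients to the value of the form.\<close>
    define a where "a = linear_form d c (pt t) - c ?v * T j t"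
    have "poly (specialize P (b(?v := z))) (a + z * T j t) = 0" for z
    proof -
      have lf: "linear_form i (c(?v := z)) x = (if i = d then linear_form d c x - c ?v * x j + z * x j
          else linear_form i c x)" for i and x :: "'n \<Rightarrow> complex"
      proof (cases "i = d")
        case True
        have "(\<Sum>k\<in>UNIV. (c(?v := z)) (d, Some k) * x k) =
            (\<Sum>k\<in>UNIV. c (d, Some k) * x k + (if k = j then (z - c ?v) * x k else 0))"
          by (intro sum.cong) (auto simp: algebra_simps)
        then show ?thesis using True
          by (simp add: linear_form_def sum.distrib sum.delta algebra_simps)
      qed (simp add: linear_form_def)
      have "translate_through d (c(?v := z)) (pt t) = b(?v := z)"
        by (auto simp: b_def translate_through_def fun_eq_iff lf)
      moreover have "linear_form d (c(?v := z)) (pt t) = a + z * T j t"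
        by (simp add: lf a_def)
      ultimately show ?thesis using assms unfolding vanishes_def by metis
    qed
    then have "((\<lambda>z. 0) has_field_derivative
        poly (specialize Q (b(?v := c ?v))) (a + c ?v * T j t) +
        T j t * poly (specialize (pderiv P) (b(?v := c ?v))) (a + c ?v * T j t)) (at (c ?v))"
      using Q[of b a "T j t" "c ?v"] by simp
    from DERIV_unique[OF this DERIV_const]
    have "poly (specialize Q (b(?v := c ?v))) (a + c ?v * T j t) =
       - (T j t * poly (specialize (pderiv P) (b(?v := c ?v))) (a + c ?v * T j t))"
      by (simp add: eq_neg_iff_add_eq_0)
    moreover have "b(?v := c ?v) = b" by (auto simp: b_def fun_eq_iff)
    moreover have "a + c ?v * T j t = linear_form d c (pt t)" by (simp add: a_def)
    ultimately show "poly (specialize Q (translate_through d c (pt t))) (linear_form d c (pt t)) =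
      - (T j t * poly (specialize (pderiv P) (translate_through d c (pt t))) (linear_form d c (pt t)))"
      by (simp add: b_def)
  qed
qed

end

text \<open>
  If all \<open>y j\<close> are fractions with the common denominator \<open>D\<close>, then \<open>G y\<close> is a fraction whose
  denominator is a power of \<open>D\<close>. The hypothesis is stated without division so that it also applies at
  zeros of \<open>D\<close>.
\<close>

lemma clear_denominators:
  fixes W :: "'n \<Rightarrow> 'v polyfun poly"
  assumes "G \<in> polyfuns"
  shows "\<exists>k F. \<forall>c \<eta> y. (\<forall>j. poly (specialize (W j) c) \<eta> = - (y j * poly (specialize D c) \<eta>)) \<longrightarrow>
    poly (specialize F c) \<eta> = poly (specialize D c) \<eta> ^ k * G y"
  using assms
proof (induction rule: polyfuns.induct)
  case (const a)
  show ?case by (rule exI[of _ 0], rule exI[of _ "[:pf_const a:]"]) simp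
next
  case (coord j)
  show ?case by (rule exI[of _ 1], rule exI[of _ "- W j"]) simp
next
  case (add f g)
  then obtain k F l G where
    F: "\<forall>c \<eta> y. (\<forall>j. poly (specialize (W j) c) \<eta> = - (y j * poly (specialize D c) \<eta>)) \<longrightarrow>
      poly (specialize F c) \<eta> = poly (specialize D c) \<eta> ^ k * f y" and
    G: "\<forall>c \<eta> y. (\<forall>j. poly (specialize (W j) c) \<eta> = - (y j * poly (specialize D c) \<eta>)) \<longrightarrow>
      poly (specialize G c) \<eta> = poly (specialize D c) \<eta> ^ l * g y" by blast
  show ?case
  proof (rule exI[of _ "k + l"], rule exI[of _ "D ^ l * F + D ^ k * G"], intro allI impI)
    fix c \<eta> y assume "\<forall>j. poly (specialize (W j) c) \<eta> = - (y j * poly (specialize D c) \<eta>)"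
    then show "poly (specialize (D ^ l * F + D ^ k * G) c) \<eta> =
        poly (specialize D c) \<eta> ^ (k + l) * (f y + g y)"
      using F[rule_format, of c \<eta> y] G[rule_format, of c \<eta> y] by (simp add: power_add algebra_simps)
  qed
next
  case (mult f g)
  then obtain k F l G where
    F: "\<forall>c \<eta> y. (\<forall>j. poly (specialize (W j) c) \<eta> = - (y j * poly (specialize D c) \<eta>)) \<longrightarrow>
      poly (specialize F c) \<eta> = poly (specialize D c) \<eta> ^ k * f y" and
    G: "\<forall>c \<eta> y. (\<forall>j. poly (specialize (W j) c) \<eta> = - (y j * poly (specialize D c) \<eta>)) \<longrightarrow>
      poly (specialize G c) \<eta> = poly (specialize D c) \<eta> ^ l * g y" by blast
  show ?case
  proof (rule exI[of _ "k + l"], rule exI[of _ "F * G"], intro allI impI)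
    fix c \<eta> y assume "\<forall>j. poly (specialize (W j) c) \<eta> = - (y j * poly (specialize D c) \<eta>)"
    then show "poly (specialize (F * G) c) \<eta> = poly (specialize D c) \<eta> ^ (k + l) * (f y * g y)"
      using F[rule_format, of c \<eta> y] G[rule_format, of c \<eta> y] by (simp add: power_add algebra_simps)
  qed
qed

context parametrized_variety
begin

text \<open>
  If the equations of a section through a point of \<open>X\<close> satisfy a relation without the auxiliary
  form, then generic sections are empty, and \<open>r = 0\<close>. Otherwise \<open>r\<close> is the degree of the minimal
  relation \<open>P\<close>, and the auxiliary form maps the section bijectively onto the roots of \<open>P\<close>. For
  surjectivity, the gradient formula defines a candidate point \<open>x\<close> for each root. All polynomial
  conditions on \<open>x\<close> (lying on \<open>X\<close>, satisfying the equations, having the given value of the form)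
  hold since, after clearing denominators, they are relations, hence multiples of \<open>P\<close> up to a power
  of its leading coefficient.
\<close>

lemma generic_section_count:
  "\<exists>g r. g \<noteq> 0 \<and> (\<forall>c. pf_eval g c \<noteq> 0 \<longrightarrow> finite (X \<inter> linear_section d c) \<and>
     card (X \<inter> linear_section d c) = r \<and>
     inj_on (\<lambda>x. linear_form d c (($) x)) (X \<inter> linear_section d c))"
proof (cases "\<exists>g. g \<noteq> 0 \<and> (\<forall>c t. pf_eval g (translate_through d c (pt t)) = 0)")
  case True
  then obtain g where g: "g \<noteq> 0" "\<And>c t. pf_eval g (translate_through d c (pt t)) = 0" by blast
  have "X \<inter> linear_section d c = {}" if "pf_eval g c \<noteq> 0" for c
  proof (rule ccontr)
    assume "X \<inter> linear_section d c \<noteq> {}"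
    then obtain x where x: "x \<in> X" "x \<in> linear_section d c" by blast
    have "pf_eval g (translate_through d c (($) x)) = 0"
    proof (rule X_vanish[OF _ _ x(1)])
      show "(\<lambda>x. pf_eval g (translate_through d c x)) \<in> polyfuns"
        by (rule polyfuns_compose[OF pf_eval])
          (intro polyfuns_translate_through polyfuns.const polyfuns.coord)
    qed (rule g)
    then show False using that translate_through_section[OF x(2)] by simp
  qed
  then show ?thesis using g(1) by (intro exI[of _ g] exI[of _ 0]) simp
next
  case False
  then have "\<And>a. (\<And>c t. pf_eval a (translate_through d c (pt t)) = 0) \<Longrightarrow> a = 0" by blast
  from separable_minimal_vanishing[OF this] obtain P \<delta> U V where
    P: "P \<noteq> 0" "vanishes P" "\<And>Q. vanishes Q \<Longrightarrow> Q \<noteq> 0 \<Longrightarrow> degree P \<le> degree Q"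
    and \<delta>: "\<delta> \<noteq> 0" "[:\<delta>:] = U * P + V * pderiv P" by blast
  define D where "D = pderiv P"
  have "\<exists>W. \<forall>j c t. poly (specialize (W j) (translate_through d c (pt t))) (linear_form d c (pt t)) =
    - (T j t * poly (specialize D (translate_through d c (pt t))) (linear_form d c (pt t)))"
    using vanishes_gradient[OF P(2)] unfolding D_def by metis
  then obtain W where W: "\<And>j c t. poly (specialize (W j) (translate_through d c (pt t))) (linear_form d c (pt t)) =
    - (T j t * poly (specialize D (translate_through d c (pt t))) (linear_form d c (pt t)))" by blast
  \<comment> \<open>By minimality of \<open>P\<close>, pseudo-division of a relation by \<open>P\<close> leaves no remainder.\<close>
  have root: "poly (specialize F c) \<eta> = 0"
    if F: "vanishes F" and c: "pf_eval (lead_coeff P) c \<noteq> 0" and \<eta>: "poly (specialize P c) \<eta> = 0"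
    for F c \<eta>
  proof -
    have lead: "coeff P (degree P) \<noteq> 0" using P(1) by simp
    obtain Q R where QR: "pseudo_divmod F P = (Q, R)" by (cases "pseudo_divmod F P")
    define a where "a = lead_coeff P ^ (Suc (degree F) - degree P)"
    have div: "smult a F = P * Q + R" and R: "R = 0 \<or> degree R < degree P"
      using pseudo_divmod[OF P(1) QR] by (simp_all add: a_def)
    have "vanishes R"
    proof -
      have "R = smult a F - P * Q" using div by simp
      then show ?thesis using F P(2) by (simp add: vanishes_def)
    qed
    then have "R = 0" using P(3)[of R] R by fastforce
    with div have "pf_eval a c * poly (specialize F c) \<eta> = poly (specialize P c) \<eta> * poly (specialize Q c) \<eta>"
      by (metis add_0_right poly_mult poly_smult specialize_simps(6,7))
    moreover have "pf_eval a c \<noteq> 0" using c by (simp add: a_def)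
    ultimately show ?thesis using \<eta> by simp
  qed
  define g where "g = lead_coeff P * \<delta>"
  have "g \<noteq> 0" using P \<delta> by (simp add: g_def)
  moreover have "finite (X \<inter> linear_section d c) \<and> card (X \<inter> linear_section d c) = degree P \<and>
     inj_on (\<lambda>x. linear_form d c (($) x)) (X \<inter> linear_section d c)" if c: "pf_eval g c \<noteq> 0" for c
  proof -
    define q where "q = specialize P c"
    define h where "h = (\<lambda>x :: complex^'n. linear_form d c (($) x))"
    define e where "e = (\<lambda>\<eta>. poly (specialize D c) \<eta>)"
    have lead: "pf_eval (lead_coeff P) c \<noteq> 0" and \<delta>c: "pf_eval \<delta> c \<noteq> 0"
      using c by (auto simp: g_def)
    have "degree q = degree P"
      using lead by (intro antisym degree_le le_degree) (auto simp: q_def coeff_eq_0)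
    have "q \<noteq> 0" using lead by (auto simp: q_def poly_eq_iff)
    have e: "e \<eta> \<noteq> 0" if "poly q \<eta> = 0" for \<eta>
    proof
      assume "e \<eta> = 0"
      have "pf_eval \<delta> c = poly (specialize [:\<delta>:] c) \<eta>" by simp
      also have "\<dots> = 0" unfolding \<delta>(2) using that \<open>e \<eta> = 0\<close> by (simp add: q_def e_def D_def)
      finally show False using \<delta>c by simp
    qed
    then have card_roots: "card {\<eta>. poly q \<eta> = 0} = degree P"
      using card_roots_rsquarefree[OF \<open>q \<noteq> 0\<close>] \<open>degree q = degree P\<close>
      by (auto simp: e_def D_def q_def)
    let ?S = "X \<inter> linear_section d c"
    have h_root: "poly q (h x) = 0" if "x \<in> ?S" for x
      using vanishes_on_X[OF P(2), of x c] translate_through_section[of x d c] that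
      by (simp add: q_def h_def)
    have grad: "poly (specialize (W j) c) (h x) = - (x $ j * e (h x))" if "x \<in> ?S" for x j
    proof -
      have "poly (specialize (W j) (translate_through d c (($) x))) (linear_form d c (($) x)) +
        x $ j * poly (specialize D (translate_through d c (($) x))) (linear_form d c (($) x)) = 0"
      proof (rule X_vanish)
        show "(\<lambda>x. poly (specialize (W j) (translate_through d c x)) (linear_form d c x) +
          x j * poly (specialize D (translate_through d c x)) (linear_form d c x)) \<in> polyfuns"
          by (intro polyfuns.add polyfuns.mult polyfuns_poly_specialize polyfuns_translate_through
              polyfuns_linear_form polyfuns.coord polyfuns.const)
        show "x \<in> X" using that by simp
      qed (simp add: W)
      then show ?thesis using translate_through_section[of x d c] that
        by (simp add: e_def h_def eq_neg_iff_add_eq_0)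
    qed
    have inj: "inj_on h ?S"
    proof (rule inj_onI)
      fix x y assume xy: "x \<in> ?S" "y \<in> ?S" "h x = h y"
      have "x $ j = y $ j" for j
        using grad[OF xy(1), of j] grad[OF xy(2), of j] e[OF h_root[OF xy(1)]] xy(3) by simp
      then show "x = y" by (simp add: vec_eq_iff)
    qed
    have "\<eta> \<in> h ` ?S" if \<eta>: "poly q \<eta> = 0" for \<eta>
    proof -
      define x where "x = (\<chi> j. - poly (specialize (W j) c) \<eta> / e \<eta>)"
      have Wx: "poly (specialize (W j) c) \<eta> = - (x $ j * e \<eta>)" for j
        using e[OF \<eta>] by (simp add: x_def)
      have zero: "poly (specialize F c) \<eta> = 0" if "vanishes F" for F
        using root[OF that lead] \<eta> by (simp add: q_def)
      have "x \<in> X"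
      proof (rule X_memI)
        fix f :: "('n \<Rightarrow> complex) \<Rightarrow> complex"
        assume f: "f \<in> polyfuns" "\<And>t. f (pt t) = 0"
        obtain k F where F: "\<And>c \<eta> y. (\<And>j. poly (specialize (W j) c) \<eta> = - (y j * poly (specialize D c) \<eta>))
            \<Longrightarrow> poly (specialize F c) \<eta> = poly (specialize D c) \<eta> ^ k * f y"
          using clear_denominators[OF f(1), of W D] by blast
        have "vanishes F" unfolding vanishes_def using F[OF W] f(2) by simp
        then have "e \<eta> ^ k * f (($) x) = 0"
          using zero F[of c \<eta> "($) x"] Wx by (simp add: e_def)
        then show "f (($) x) = 0" using e[OF \<eta>] by simp
      qed
      moreover have "x \<in> linear_section d c"
        unfolding linear_section_def
      proof (intro CollectI allI impI)
        fix i assume i: "i < d"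
        let ?F = "(\<Sum>j\<in>UNIV. [:pf_coord (i, Some j):] * W j) - [:pf_coord (i, None):] * D"
        have "vanishes ?F"
          using i by (simp add: vanishes_def W poly_sum sum_negf)
            (simp add: linear_form_def[of i] sum_distrib_right mult.assoc)
        then have "poly (specialize ?F c) \<eta> = 0" by (rule zero)
        then have "((\<Sum>j\<in>UNIV. c (i, Some j) * x $ j) + c (i, None)) * e \<eta> = 0"
          by (simp add: Wx poly_sum sum_negf sum_distrib_right distrib_right mult.assoc add_eq_0_iff e_def)
        then show "(\<Sum>j\<in>UNIV. c (i, Some j) * x $ j) + c (i, None) = 0" using e[OF \<eta>] by simp
      qed
      moreover have "h x = \<eta>"
      proof -
        let ?F = "(\<Sum>j\<in>UNIV. [:pf_coord (d, Some j):] * W j) + [:0, 1:] * D"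
        have "vanishes ?F"
          by (simp add: vanishes_def W poly_sum sum_negf)
            (simp add: linear_form_def sum_distrib_right mult.assoc)
        then have "poly (specialize ?F c) \<eta> = 0" by (rule zero)
        then have "h x * e \<eta> = \<eta> * e \<eta>"
          by (simp add: Wx poly_sum sum_negf sum_distrib_right mult.assoc e_def h_def linear_form_def)
        then show ?thesis using e[OF \<eta>] by simp
      qed
      ultimately show ?thesis by blast
    qed
    then have image: "h ` ?S = {\<eta>. poly q \<eta> = 0}" using h_root by blast
    have "card ?S = degree P" using card_image[OF inj] image card_roots by simp
    moreover have "finite ?S"
      using finite_imageD[OF _ inj] image poly_roots_finite[OF \<open>q \<noteq> 0\<close>] by simp
    ultimately show ?thesis using inj by (simp add: h_def)
  qed
  ultimately show ?thesis by blast
qed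

end

section \<open>Generic sections have the expected codimension\<close>

lemma polyfuns_det:
  fixes N :: "('v \<Rightarrow> complex) \<Rightarrow> complex^'n^'n"
  assumes "\<And>i j. (\<lambda>y. N y $ i $ j) \<in> polyfuns"
  shows "(\<lambda>y. det (N y)) \<in> polyfuns"
  unfolding det_def by (intro polyfuns_intros assms)

text \<open>
  Wherever a certain determinant in the coefficients does not vanish, a linear change of coordinates
  turns the equations into conditions on single coordinates.
\<close>

lemma generic_linear_section_dim:
  assumes d: "d \<le> CARD('n)"
  shows "\<exists>f\<in>polyfuns. (\<exists>c. f c \<noteq> 0) \<and> (\<forall>c. f c \<noteq> 0 \<longrightarrow>
    affine_linear_space (CARD('n) - d) (linear_section d c :: (complex^'n) set))"
proof -
  obtain \<tau> :: "nat \<Rightarrow> 'n" where \<tau>: "bij_betw \<tau> {0..<CARD('n)} UNIV"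
    using ex_bij_betw_nat_finite[of "UNIV :: 'n set"] by auto
  define \<nu> where "\<nu> = the_inv_into {0..<CARD('n)} \<tau>"
  have \<nu>\<tau>: "\<nu> (\<tau> i) = i" if "i < CARD('n)" for i
    using \<tau> that by (simp add: \<nu>_def the_inv_into_f_f bij_betw_imp_inj_on)
  have \<tau>\<nu>: "\<tau> (\<nu> k) = k" for k
    using \<tau> by (auto simp: \<nu>_def intro!: f_the_inv_into_f_bij_betw)
  have \<nu>_less: "\<nu> k < CARD('n)" for k
    using \<tau> bij_betw_the_inv_into[OF \<tau>] by (auto simp: \<nu>_def bij_betw_def)
  \<comment> \<open>The coefficient matrix of the equations, completed by unit vectors to a square matrix.\<close>
  define N :: "(nat \<times> 'n option \<Rightarrow> complex) \<Rightarrow> complex^'n^'n" where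
    "N = (\<lambda>c. \<chi> k j. if \<nu> k < d then c (\<nu> k, Some j) else if k = j then 1 else 0)"
  \<comment> \<open>At these coefficients the completed matrix is the identity, so its determinant is not the zero polynomial.\<close>
  let ?c = "\<lambda>(i, k). if k = Some (\<tau> i) then 1 else 0 :: complex"
  have "N ?c = mat 1"
    by (auto simp: N_def mat_def vec_eq_iff \<tau>\<nu>)
  then have 1: "det (N ?c) \<noteq> 0" by simp
  have 2: "(\<lambda>c. det (N c)) \<in> polyfuns"
  proof (rule polyfuns_det)
    fix i j
    show "(\<lambda>c. N c $ i $ j) \<in> polyfuns"
      by (cases "\<nu> i < d") (simp_all add: N_def polyfuns.coord polyfuns.const)
  qed
  have "affine_linear_space (CARD('n) - d) (linear_section d c :: (complex^'n) set)"
    if "det (N c) \<noteq> 0" for c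
  proof -
    have "invertible (N c)" using that by (simp add: invertible_det_nz)
    then obtain M where M: "M ** N c = mat 1" "N c ** M = mat 1"
      unfolding invertible_def by blast
    have NM: "N c *v (M *v y) = y" "M *v (N c *v y) = y" for y
      by (simp_all add: matrix_vector_mul_assoc M)
    have Nk: "(N c *v x) $ k = (\<Sum>j\<in>UNIV. c (\<nu> k, Some j) * x $ j)" if "\<nu> k < d" for x k
      using that by (simp add: N_def matrix_vector_mult_def)
    define Y :: "(complex^'n) set" where "Y = {y. \<forall>k. k \<notin> {k. d \<le> \<nu> k} \<longrightarrow> y $ k = 0}"
    define p where "p = M *v (\<chi> k. if \<nu> k < d then - c (\<nu> k, None) else 0)"
    have sub: "vec.subspace Y" unfolding Y_def vec.subspace_def by simp
    have "bij_betw \<nu> {k. d \<le> \<nu> k} {d..<CARD('n)}"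
      by (rule bij_betw_byWitness[where f' = \<tau>]) (auto simp: \<tau>\<nu> \<nu>\<tau> \<nu>_less)
    then have "card {k. d \<le> \<nu> k} = CARD('n) - d" by (simp add: bij_betw_same_card)
    then have dimY: "vec.dim Y = CARD('n) - d" unfolding Y_def dim_substandard_cart by simp
    have "linear_section d c = (+) p ` ((*v) M ` Y)"
    proof (intro equalityI subsetI)
      fix x assume x: "x \<in> linear_section d c"
      have "N c *v (x - p) \<in> Y"
        unfolding Y_def
      proof (intro CollectI allI impI)
        fix k assume "k \<notin> {k. d \<le> \<nu> k}"
        then have k: "\<nu> k < d" by simp
        have "(N c *v p) $ k = - c (\<nu> k, None)" using k by (simp add: p_def NM)
        moreover have "(N c *v x) $ k = - c (\<nu> k, None)"
          using x k unfolding Nk[OF k] by (simp add: linear_section_def add_eq_0_iff)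
        ultimately show "(N c *v (x - p)) $ k = 0" by (simp add: matrix_vector_mult_diff_distrib)
      qed
      moreover have "x = p + M *v (N c *v (x - p))" by (simp add: NM)
      ultimately show "x \<in> (+) p ` ((*v) M ` Y)" by blast
    next
      fix x assume "x \<in> (+) p ` ((*v) M ` Y)"
      then obtain y where y: "y \<in> Y" "x = p + M *v y" by blast
      show "x \<in> linear_section d c"
        unfolding linear_section_def
      proof (intro CollectI allI impI)
        fix i assume i: "i < d"
        define k where "k = \<tau> i"
        have k: "\<nu> k = i" using i d by (simp add: k_def \<nu>\<tau>)
        have "(N c *v x) $ k = - c (i, None)"
          using y i k by (simp add: matrix_vector_right_distrib NM p_def Y_def)
        then show "(\<Sum>j\<in>UNIV. c (i, Some j) * x $ j) + c (i, None) = 0"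
          using Nk[of k x] i k by simp
      qed
    qed
    moreover have "vec.subspace ((*v) M ` Y)"
      by (rule vec.subspace_image[OF sub])
    moreover have "inj ((*v) M)" using NM by (metis injI)
    then have "vec.dim ((*v) M ` Y) = CARD('n) - d"
      using vec.dim_image_eq[of "(*v) M" Y] dimY by (simp add: inj_on_subset)
    ultimately show ?thesis unfolding affine_linear_space_def by blast
  qed
  with 1 2 show ?thesis by (intro bexI[of _ "\<lambda>c. det (N c)"]) auto
qed

section \<open>Lattice points in dilated convex bodies\<close>

definition lattice_points :: "(real^'m::finite) set \<Rightarrow> nat \<Rightarrow> ('m \<Rightarrow> nat) set" where
  "lattice_points K k = {e. (\<chi> i. real (e i)) \<in> (*\<^sub>R) (real k) ` K}"

lemma finite_lattice_points:
  assumes "bounded K"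
  shows "finite (lattice_points K k)"
proof -
  obtain B where B: "\<And>x. x \<in> K \<Longrightarrow> norm x \<le> B" using assms unfolding bounded_iff by blast
  have "e i \<le> nat \<lceil>real k * B\<rceil>" if "e \<in> lattice_points K k" for e i
  proof -
    obtain x where x: "x \<in> K" "(\<chi> i. real (e i)) = real k *\<^sub>R x"
      using \<open>e \<in> lattice_points K k\<close> unfolding lattice_points_def by auto
    have "real (e i) = real k * x $ i" using x(2) by (simp add: vec_eq_iff)
    also have "\<dots> \<le> real k * B"
      using B[OF x(1)] component_le_norm_cart[of x i] by (intro mult_left_mono) auto
    finally show ?thesis by linarith
  qed
  then have "lattice_points K k \<subseteq> degree_box (nat \<lceil>real k * B\<rceil>)" by blast
  then show ?thesis using degree_box(1) finite_subset by blast
qed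

text \<open>
  A sum of points of \<open>k K\<close> and \<open>l K\<close> is \<open>k + l\<close> times a convex combination of points of \<open>K\<close>;
  if \<open>k = l = 0\<close>, both points are \<open>0\<close>.
\<close>

lemma lattice_points_add:
  assumes K: "convex K" "0 \<in> K" and e: "e \<in> lattice_points K k" "e' \<in> lattice_points K l"
  shows "(\<lambda>i. e i + e' i) \<in> lattice_points K (k + l)"
proof -
  obtain x y where xy: "x \<in> K" "(\<chi> i. real (e i)) = real k *\<^sub>R x"
    "y \<in> K" "(\<chi> i. real (e' i)) = real l *\<^sub>R y"
    using e unfolding lattice_points_def by auto
  have sum: "(\<chi> i. real (e i + e' i)) = real k *\<^sub>R x + real l *\<^sub>R y"
    using xy by (simp add: vec_eq_iff)
  show ?thesis
  proof (cases "k + l = 0")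
    case True
    then show ?thesis using K sum by (auto simp: lattice_points_def intro!: image_eqI[of _ _ 0])
  next
    case False
    have "(real k / real (k + l)) *\<^sub>R x + (real l / real (k + l)) *\<^sub>R y \<in> K"
      using K xy False by (intro convexD) (auto simp: add_divide_distrib[symmetric])
    moreover have "real (k + l) *\<^sub>R ((real k / real (k + l)) *\<^sub>R x + (real l / real (k + l)) *\<^sub>R y)
        = real k *\<^sub>R x + real l *\<^sub>R y"
      using False by (simp add: scaleR_add_right del: of_nat_add)
    ultimately show ?thesis unfolding lattice_points_def mem_Collect_eq sum by (metis image_eqI)
  qed
qed

lemma lattice_points_mono:
  assumes K: "convex K" "0 \<in> K" and "k \<le> l"
  shows "lattice_points K k \<subseteq> lattice_points K l"
proof
  fix e assume e: "e \<in> lattice_points K k"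
  have "(\<lambda>_. 0) \<in> lattice_points K (l - k)"
    using K by (auto simp: lattice_points_def vec_eq_iff intro!: image_eqI[of _ _ 0])
  from lattice_points_add[OF K e this] show "e \<in> lattice_points K l" using \<open>k \<le> l\<close> by simp
qed

text \<open>
  The open cubes of side \<open>1 / k\<close> attached to the scaled lattice points of \<open>k K\<close> are disjoint and,
  for large \<open>k\<close>, contained in any given open neighbourhood of the compact set \<open>K\<close>, which can be
  chosen with volume close to that of \<open>K\<close>.
\<close>

lemma card_lattice_points_le:
  fixes K :: "(real^'m) set"
  assumes K: "compact K" and \<epsilon>: "\<epsilon> > 0"
  shows "eventually (\<lambda>k. real (card (lattice_points K k)) \<le> real k ^ CARD('m) * (measure lebesgue K + \<epsilon>))
    sequentially"
proof -
  have Km: "K \<in> lmeasurable" using K by (rule lmeasurable_compact)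
  then have "K \<in> sets lebesgue" by blast
  then obtain U where U: "open U" "K \<subseteq> U" "U - K \<in> lmeasurable" "emeasure lebesgue (U - K) < ennreal \<epsilon>"
    using sets_lebesgue_outer_open[OF _ \<epsilon>] by metis
  have Um: "U \<in> lmeasurable"
    using fmeasurable.Un[OF Km U(3)] U(2) by (simp add: Un_absorb1)
  have "measure lebesgue U = measure lebesgue K + measure lebesgue (U - K)"
    using measure_Un2[OF Km Um] U(2) by (simp add: Un_absorb1)
  also have "measure lebesgue (U - K) \<le> \<epsilon>"
    using U(3,4) \<epsilon> by (simp add: emeasure_eq_measure2 ennreal_less_iff)
  finally have mU: "measure lebesgue U \<le> measure lebesgue K + \<epsilon>" by simp
  obtain \<delta> where \<delta>: "\<delta> > 0" "(\<Union>x\<in>K. ball x \<delta>) \<subseteq> U"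
    using compact_subset_open_imp_ball_epsilon_subset[OF K U(1,2)] by blast
  have "eventually (\<lambda>k. real k > real CARD('m) / \<delta>) sequentially"
    using filterlim_real_sequentially filterlim_at_top_dense by blast
  then show ?thesis
  proof (eventually_elim)
    case (elim k)
    have "real k > 0"
      using elim \<delta>(1) by (meson divide_nonneg_pos of_nat_0_le_iff order_le_less_trans)
    then have k: "k > 0" by simp
    define b where "b = (\<lambda>e :: 'm \<Rightarrow> nat. box (\<chi> i. real (e i) / k) (\<chi> i. (real (e i) + 1) / k) :: (real^'m) set)"
    have b_iff: "x \<in> b e \<longleftrightarrow> (\<forall>i. real (e i) < k * x $ i \<and> k * x $ i < real (e i) + 1)" for x e
      using k by (auto simp: b_def mem_box_cart field_simps)
    have fin: "finite (lattice_points K k)"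
      using K compact_imp_bounded finite_lattice_points by blast
    have b_meas: "b e \<in> lmeasurable" for e by (simp add: b_def)
    have b_size: "measure lebesgue (b e) = (1 / k) ^ CARD('m)" for e
    proof -
      have "measure lebesgue (b e) = measure lborel (cbox (\<chi> i. real (e i) / k) (\<chi> i. (real (e i) + 1) / k) :: (real^'m) set)"
        by (simp add: b_def measure_lborel_box_eq measure_lborel_cbox_eq)
      also have "\<dots> = (\<Prod>i\<in>(UNIV :: 'm set). (real (e i) + 1) / k - real (e i) / k)"
        using k by (subst content_cbox_cart) (auto simp: interval_ne_empty_cart divide_right_mono)
      also have "\<dots> = (1 / k) ^ CARD('m)" by (simp add: diff_divide_distrib[symmetric])
      finally show ?thesis .
    qed
    have disj: "disjnt (b e) (b e')" if "e \<noteq> e'" for e e'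
    proof -
      obtain i where i: "e i \<noteq> e' i" using \<open>e \<noteq> e'\<close> by auto
      have False if "x \<in> b e" "x \<in> b e'" for x
      proof -
        have "real (e i) < real (e' i) + 1" "real (e' i) < real (e i) + 1"
          using that unfolding b_iff by (meson less_trans)+
        then show False using i by linarith
      qed
      then show ?thesis unfolding disjnt_iff by blast
    qed
    have sub: "b e \<subseteq> U" if "e \<in> lattice_points K k" for e
    proof
      fix x assume x: "x \<in> b e"
      obtain y where y: "y \<in> K" "(\<chi> i. real (e i)) = real k *\<^sub>R y"
        using \<open>e \<in> lattice_points K k\<close> by (auto simp: lattice_points_def)
      have ey: "real (e i) = k * y $ i" for i using y(2) by (simp add: vec_eq_iff)
      have "\<bar>(x - y) $ i\<bar> \<le> 1 / k" for i
      proof -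
        have "k * y $ i < k * x $ i" "k * x $ i < k * y $ i + 1" using x unfolding b_iff ey by auto
        then have "0 < k * (x $ i - y $ i)" "k * (x $ i - y $ i) < 1" by (auto simp: algebra_simps)
        then show ?thesis using k by (simp add: abs_le_iff field_simps zero_less_mult_iff)
      qed
      then have "(\<Sum>i\<in>UNIV. \<bar>(x - y) $ i\<bar>) \<le> (\<Sum>i\<in>(UNIV :: 'm set). 1 / k)" by (intro sum_mono)
      then have "norm (x - y) \<le> CARD('m) / k" using norm_le_l1_cart[of "x - y"] by simp
      also have "\<dots> < \<delta>" using elim k \<delta> by (simp add: field_simps)
      finally have "x \<in> ball y \<delta>" by (simp add: dist_norm norm_minus_commute)
      then show "x \<in> U" using \<delta>(2) y(1) by blast
    qed
    have "real (card (lattice_points K k)) * (1 / k) ^ CARD('m) = (\<Sum>e\<in>lattice_points K k. measure lebesgue (b e))"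
      by (simp add: b_size)
    also have "\<dots> = measure lebesgue (\<Union>e\<in>lattice_points K k. b e)"
      using fin b_meas disj by (intro measure_UNION'[symmetric]) (auto simp: pairwise_def)
    also have "\<dots> \<le> measure lebesgue U"
      using sub fin b_meas Um by (intro measure_mono_fmeasurable) (auto intro!: sets.finite_UN)
    also have "\<dots> \<le> measure lebesgue K + \<epsilon>" by (rule mU)
    finally show ?case using k by (simp add: field_simps power_divide)
  qed
qed

section \<open>Counting points of a section by volume\<close>

lemma power_le_fact_binomial: "k ^ m \<le> fact m * ((k + m) choose m)"
proof (induction m)
  case (Suc m)
  have "fact (Suc m) * ((k + Suc m) choose Suc m) = fact m * (Suc m * (Suc (k + m) choose Suc m))"
    by (simp add: algebra_simps)
  also have "\<dots> = Suc (k + m) * (fact m * ((k + m) choose m))"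
    by (simp only: Suc_times_binomial) (simp add: algebra_simps)
  finally have eq: "fact (Suc m) * ((k + Suc m) choose Suc m) = Suc (k + m) * (fact m * ((k + m) choose m))" .
  have "k ^ Suc m = k * k ^ m" by simp
  also have "\<dots> \<le> Suc (k + m) * (fact m * ((k + m) choose m))"
    using Suc.IH by (intro mult_mono) auto
  finally show ?case using eq by simp
qed simp

lemma monomial_span_lattice_power:
  assumes K: "convex K" "0 \<in> K" "bounded K" and f: "f \<in> monomial_span (lattice_points K k)"
  shows "(\<lambda>x. f x ^ n) \<in> monomial_span (lattice_points K (n * k))"
proof (induction n)
  case 0
  have "(\<lambda>x. 1) \<in> monomial_span {\<lambda>_. 0}"
    by (rule monomial_spanI[where a = "\<lambda>_. 1"]) simp
  then have "(\<lambda>x. 1) \<in> monomial_span (lattice_points K 0)"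
    by (rule monomial_span_mono[OF _ _ finite_lattice_points[OF K(3)]])
      (use K in \<open>auto simp: lattice_points_def vec_eq_iff intro!: image_eqI[of _ _ 0]\<close>)
  then show ?case by simp
next
  case (Suc n)
  have "(\<lambda>x. f x * f x ^ n) \<in> monomial_span (lattice_points K (k + n * k))"
    by (rule monomial_span_mult[OF f Suc.IH])
      (use K in \<open>auto intro: lattice_points_add finite_lattice_points\<close>)
  then show ?case by simp
qed

lemma monomial_span_lattice_prod:
  assumes K: "convex K" "0 \<in> K" "bounded K"
    and "finite I" "\<And>i. i \<in> I \<Longrightarrow> f i \<in> monomial_span (lattice_points K (k i))"
  shows "(\<lambda>x. \<Prod>i\<in>I. f i x) \<in> monomial_span (lattice_points K (\<Sum>i\<in>I. k i))"
  using assms(4,5)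
proof (induction I rule: finite_induct)
  case empty
  have "(\<lambda>x. 0) \<in> monomial_span (lattice_points K 0)" by (rule monomial_span_zero)
  from monomial_span_lattice_power[OF K this, of 0] show ?case by simp
next
  case (insert i I)
  have "(\<lambda>x. f i x * (\<Prod>i\<in>I. f i x)) \<in> monomial_span (lattice_points K (k i + (\<Sum>i\<in>I. k i)))"
    by (rule monomial_span_mult[of _ "lattice_points K (k i)" _ "lattice_points K (\<Sum>i\<in>I. k i)"])
      (use K insert in \<open>auto intro: lattice_points_add finite_lattice_points\<close>)
  then show ?case using insert.hyps by simp
qed

context parametrized_variety
begin

text \<open>
  For generic constant terms \<open>v\<close> the other \<open>linear_form i c0\<close> are constant on the section, so the
  relation becomes a polynomial of degree less than \<open>r\<close> in the auxiliary form, which has \<open>r\<close> distinct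
  values there. Hence its coefficients \<open>A j v\<close> vanish for generic \<open>v\<close>, so identically.
\<close>

lemma section_coordinates_independent:
  fixes g :: "(nat \<times> 'n option) polyfun"
  assumes g: "pf_eval g c0 \<noteq> 0"
    and count: "\<And>c. pf_eval g c \<noteq> 0 \<Longrightarrow> card (X \<inter> linear_section d c) = r \<and>
      inj_on (\<lambda>x. linear_form d c (($) x)) (X \<inter> linear_section d c)"
    and I: "finite I" "\<And>l l'. l \<in> I \<Longrightarrow> l' \<in> I \<Longrightarrow> (\<And>i. i < d \<Longrightarrow> \<phi> l i = \<phi> l' i) \<Longrightarrow> l = l'"
    and rel: "\<And>t. (\<Sum>(l, j)\<in>I \<times> {..<r}. a (l, j) *
      ((\<Prod>i<d. linear_form i c0 (pt t) ^ \<phi> l i) * linear_form d c0 (pt t) ^ j)) = 0"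
    and lj: "l \<in> I" "j < r"
  shows "a (l, j) = 0"
proof -
  define A where "A = (\<lambda>j v. \<Sum>l\<in>I. a (l, j) * (\<Prod>i<d. (v i :: complex) ^ \<phi> l i))"
  \<comment> \<open>The coefficients of the section on which the first \<open>d\<close> linear forms take the values \<open>v\<close>.\<close>
  define c where "c = (\<lambda>v (i, k). if k = None \<and> i < d then - v i else c0 (i, k))"
  have relX: "(\<Sum>j<r. A j (\<lambda>i. linear_form i c0 (($) x)) * linear_form d c0 (($) x) ^ j) = 0"
    if "x \<in> X" for x
  proof (rule X_vanish[OF _ _ that])
    show "(\<lambda>x. \<Sum>j<r. A j (\<lambda>i. linear_form i c0 x) * linear_form d c0 x ^ j) \<in> polyfuns"
      unfolding A_def by (intro polyfuns_intros polyfuns_linear_form)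
    show "(\<Sum>j<r. A j (\<lambda>i. linear_form i c0 (pt t)) * linear_form d c0 (pt t) ^ j) = 0" for t
      using rel[of t] unfolding A_def
      by (simp add: sum.cartesian_product[symmetric] sum.swap[of _ I] sum_distrib_right mult.assoc)
  qed
  have A0: "A j v = 0" if "j < r" "pf_eval g (c v) \<noteq> 0" for j v
  proof -
    let ?S = "X \<inter> linear_section d (c v)"
    let ?h = "\<lambda>x :: complex^'n. linear_form d (c v) (($) x)"
    have h: "?h x = linear_form d c0 (($) x)" for x
      by (simp add: linear_form_def c_def)
    define q where "q = (\<Sum>j<r. monom (A j v) j)"
    have "poly q (?h x) = 0" if x: "x \<in> ?S" for x
    proof -
      have "linear_form i c0 (($) x) = v i" if "i < d" for i
        using x that by (simp add: linear_section_def linear_form_def c_def)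
      then have "A j (\<lambda>i. linear_form i c0 (($) x)) = A j v" for j
        unfolding A_def by (intro sum.cong arg_cong2[where f = "(*)"] prod.cong) auto
      then show ?thesis using relX[of x] x h
        by (simp add: q_def poly_sum poly_monom)
    qed
    then have roots: "?h ` ?S \<subseteq> {z. poly q z = 0}" by auto
    have "q = 0"
    proof (rule ccontr)
      assume "q \<noteq> 0"
      have "r = card (?h ` ?S)" using count[OF \<open>pf_eval g (c v) \<noteq> 0\<close>] by (simp add: card_image)
      also have "\<dots> \<le> card {z. poly q z = 0}"
        using roots poly_roots_finite[OF \<open>q \<noteq> 0\<close>] by (intro card_mono)
      also have "\<dots> \<le> degree q" using \<open>q \<noteq> 0\<close> by (rule card_poly_roots_bound)
      also have "\<dots> \<le> r - 1" unfolding q_def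
        by (intro degree_sum_le) (auto intro: order_trans[OF degree_monom_le])
      finally show False using \<open>j < r\<close> by simp
    qed
    then have "coeff q j = 0" by simp
    then show ?thesis using \<open>j < r\<close> by (simp add: q_def coeff_sum)
  qed
  have "(\<lambda>v. c v w) \<in> polyfuns" for w
  proof (cases w)
    case (Pair i k)
    then show ?thesis
      by (cases k; cases "i < d") (simp_all add: c_def polyfuns_uminus polyfuns.coord polyfuns.const)
  qed
  then have "(\<lambda>v. pf_eval g (c v)) \<in> polyfuns" by (rule polyfuns_compose[OF pf_eval])
  moreover have "A j \<in> polyfuns" unfolding A_def by (intro polyfuns_intros)
  moreover have "pf_eval g (c v) * A j v = 0" for v using A0[OF lj(2)] by auto
  ultimately have "(\<forall>v. pf_eval g (c v) = 0) \<or> (\<forall>v. A j v = 0)"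
    by (rule polyfuns_no_zero_divisors)
  \<comment> \<open>So \<open>g\<close> does not vanish identically on the sections in question.\<close>
  moreover have "c (\<lambda>i. - c0 (i, None)) = c0" by (auto simp: c_def)
  ultimately have Aj: "A j v = 0" for v using g by metis
  show ?thesis
    by (rule monomials_independent[OF _ I(1), of "{..<d}" \<phi> "\<lambda>l. a (l, j)"])
      (use Aj I(2) lj in \<open>auto simp: A_def\<close>)
qed

text \<open>
  The independent products of linear forms are combinations of monomials with exponents in
  \<open>(k + r) K\<close>, so there are at most as many of them as lattice points.
\<close>

lemma section_count_lattice_bound:
  fixes g :: "(nat \<times> 'n option) polyfun"
  assumes K: "compact K" "convex K" "0 \<in> K"
    and TK: "\<And>j. T j \<in> monomial_span (lattice_points K 1)"
    and g: "pf_eval g c0 \<noteq> 0"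
    and count: "\<And>c. pf_eval g c \<noteq> 0 \<Longrightarrow> card (X \<inter> linear_section d c) = r \<and>
      inj_on (\<lambda>x. linear_form d c (($) x)) (X \<inter> linear_section d c)"
  shows "((k + d) choose d) * r \<le> card (lattice_points K (k + r))"
proof (rule ccontr)
  have bK: "bounded K" using K compact_imp_bounded by blast
  note fin = finite_lattice_points[OF bK]
  assume neg: "\<not> ?thesis"
  \<comment> \<open>The last entry of a list of length \<open>Suc d\<close> takes up the slack of an exponent of degree at most \<open>k\<close>.\<close>
  define I where "I = {l :: nat list. length l = Suc d \<and> sum_list l = k}"
  have "I \<subseteq> {l. set l \<subseteq> {..k} \<and> length l = Suc d}"
    by (auto simp: I_def dest: member_le_sum_list)
  then have finI: "finite I" by (rule finite_subset) (simp add: finite_lists_length_eq)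
  have "card I = (k + d) choose d"
    unfolding I_def card_length_sum_list using binomial_symmetric[of k "k + d"] by simp
  then have less: "card (lattice_points K (k + r)) < card (I \<times> {..<r})"
    using neg by (simp add: card_cartesian_product)
  have form: "(\<lambda>t. linear_form i c0 (pt t)) \<in> monomial_span (lattice_points K 1)" for i
    unfolding linear_form_def by (intro monomial_span_sum monomial_span_cmult TK)
  define F where "F = (\<lambda>(l, j) t. (\<Prod>i<d. linear_form i c0 (pt t) ^ (l ! i)) * linear_form d c0 (pt t) ^ j)"
  have F: "F b \<in> monomial_span (lattice_points K (k + r))" if b: "b \<in> I \<times> {..<r}" for b
  proof -
    obtain l j where b': "b = (l, j)" "l \<in> I" "j < r" using b by auto
    have 1: "(\<lambda>t. \<Prod>i<d. linear_form i c0 (pt t) ^ (l ! i)) \<in>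
        monomial_span (lattice_points K (\<Sum>i<d. l ! i * 1))"
      by (intro monomial_span_lattice_prod monomial_span_lattice_power K bK form) auto
    have 2: "(\<lambda>t. linear_form d c0 (pt t) ^ j) \<in> monomial_span (lattice_points K (j * 1))"
      by (intro monomial_span_lattice_power K bK form)
    have Fb: "F b \<in> monomial_span (lattice_points K ((\<Sum>i<d. l ! i * 1) + j * 1))"
      unfolding F_def b' prod.case
      by (rule monomial_span_mult[OF 1 2]) (auto intro: lattice_points_add K fin)
    have "(\<Sum>i<d. l ! i) \<le> k"
    proof -
      have "k = (\<Sum>i<Suc d. l ! i)" using b'(2) by (auto simp: I_def sum_list_sum_nth atLeast0LessThan)
      then show ?thesis by simp
    qed
    then have "(\<Sum>i<d. l ! i * 1) + j * 1 \<le> k + r" using b'(3) by simp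
    from lattice_points_mono[OF K(2,3) this] show ?thesis
      by (rule monomial_span_mono[OF Fb _ fin])
  qed
  have finIr: "finite (I \<times> {..<r})" using finI by simp
  from monomial_span_linear_dependence[OF fin finIr less F]
  obtain a where a: "(\<exists>b\<in>I \<times> {..<r}. a b \<noteq> 0) \<and> (\<forall>t. (\<Sum>b\<in>I \<times> {..<r}. a b * F b t) = 0)" ..
  from a[THEN conjunct1] obtain l j where lj: "l \<in> I" "j < r" "a (l, j) \<noteq> 0"
    by (elim bexE SigmaE) simp
  have "a (l, j) = 0"
  proof (rule section_coordinates_independent[OF g count finI, where \<phi> = "(!)"])
    fix l l' assume l: "l \<in> I" "l' \<in> I" and eq: "\<And>i. i < d \<Longrightarrow> l ! i = l' ! i"
    have "(\<Sum>i<Suc d. l ! i) = (\<Sum>i<Suc d. l' ! i)"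
      using l by (auto simp: I_def sum_list_sum_nth atLeast0LessThan)
    moreover have "(\<Sum>i<d. l ! i) = (\<Sum>i<d. l' ! i)" using eq by simp
    ultimately have "l ! d = l' ! d" by simp
    then have "l ! i = l' ! i" if "i < Suc d" for i using eq that less_Suc_eq by blast
    then show "l = l'" using l by (intro nth_equalityI) (auto simp: I_def)
  next
    fix t
    show "(\<Sum>(l, j)\<in>I \<times> {..<r}. a (l, j) * ((\<Prod>i<d. linear_form i c0 (pt t) ^ l ! i) *
        linear_form d c0 (pt t) ^ j)) = 0"
      using a[THEN conjunct2, rule_format, of t] by (simp add: F_def split_beta)
  qed (use lj in auto)
  with lj show False by simp
qed

text \<open>
  Leading terms for large \<open>k\<close>: the binomial coefficient grows like \<open>k ^ d / fact d\<close>, and the number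
  of lattice points is asymptotically at most \<open>k ^ d\<close> times the volume of \<open>K\<close>.
\<close>

lemma section_count_le_volume:
  fixes g :: "(nat \<times> 'n option) polyfun"
  assumes K: "compact K" "convex K" "0 \<in> K"
    and TK: "\<And>j. T j \<in> monomial_span (lattice_points K 1)"
    and g: "g \<noteq> 0"
    and count: "\<And>c. pf_eval g c \<noteq> 0 \<Longrightarrow> card (X \<inter> linear_section d c) = r \<and>
      inj_on (\<lambda>x. linear_form d c (($) x)) (X \<inter> linear_section d c)"
  shows "real r \<le> fact d * measure lebesgue K"
proof (rule field_le_epsilon)
  fix e :: real assume e: "e > 0"
  define \<epsilon> where "\<epsilon> = e / fact d"
  have \<epsilon>: "\<epsilon> > 0" using e by (simp add: \<epsilon>_def)
  let ?C = "fact d * (measure lebesgue K + \<epsilon>)"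
  obtain c0 where c0: "pf_eval g c0 \<noteq> 0" using g polyfun_nonzero_iff by blast
  have "eventually (\<lambda>k. real (card (lattice_points K (k + r))) \<le>
      real (k + r) ^ d * (measure lebesgue K + \<epsilon>)) sequentially"
    using sequentially_offset[OF card_lattice_points_le[OF K(1) \<epsilon>], of r] by (simp add: d)
  moreover have "eventually (\<lambda>k. k > 0) sequentially" by (rule eventually_gt_at_top)
  ultimately have "eventually (\<lambda>k. real r \<le> ?C * (1 + real r / real k) ^ d) sequentially"
  proof (eventually_elim)
    case (elim k)
    have "real k ^ d * real r \<le> fact d * real ((k + d) choose d) * real r"
      using power_le_fact_binomial[of k d]
      by (intro mult_right_mono) (metis of_nat_fact of_nat_le_iff of_nat_mult of_nat_power, simp)
    also have "\<dots> \<le> fact d * real (card (lattice_points K (k + r)))"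
      using section_count_lattice_bound[OF K TK c0 count, of k]
      by (simp add: mult.assoc flip: of_nat_mult)
    also have "\<dots> \<le> fact d * (real (k + r) ^ d * (measure lebesgue K + \<epsilon>))"
      using elim(1) by (intro mult_left_mono) auto
    finally have "real k ^ d * real r \<le> ?C * real (k + r) ^ d" by (simp add: algebra_simps)
    then have "real r \<le> ?C * real (k + r) ^ d / real k ^ d" using elim(2) by (simp add: field_simps)
    also have "\<dots> = ?C * (real (k + r) / real k) ^ d" by (simp add: power_divide)
    also have "real (k + r) / real k = 1 + real r / real k"
      using elim(2) by (simp add: add_divide_distrib)
    finally show ?case .
  qed
  moreover have "(\<lambda>k. ?C * (1 + real r / real k) ^ d) \<longlonglongrightarrow> ?C * (1 + 0) ^ d"
    by (intro tendsto_intros tendsto_divide_0[OF tendsto_const] filterlim_at_top_imp_at_infinity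
        filterlim_real_sequentially)
  ultimately have "real r \<le> ?C * (1 + 0) ^ d"
    by (intro tendsto_lowerbound[where F = sequentially]) auto
  then show "real r \<le> fact d * measure lebesgue K + e" by (simp add: \<epsilon>_def distrib_left)
qed

end

section \<open>Newton polytopes of tensor Chebyshev polynomials\<close>

definition exponents_le :: "'v cpoly \<Rightarrow> ('v \<Rightarrow> nat) \<Rightarrow> bool" where
  "exponents_le p b \<longleftrightarrow> (\<forall>e\<in>Poly_Mapping.keys p. \<forall>i. Poly_Mapping.lookup e i \<le> b i)"

lemma exponents_le_mono: "exponents_le p b \<Longrightarrow> (\<And>i. b i \<le> b' i) \<Longrightarrow> exponents_le p b'"
  unfolding exponents_le_def by (meson order_trans)

lemma exponents_le_add: "exponents_le p b \<Longrightarrow> exponents_le q b \<Longrightarrow> exponents_le (p + q) b"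
  unfolding exponents_le_def using keys_add[of p q] by blast

lemma exponents_le_uminus: "exponents_le p b \<Longrightarrow> exponents_le (- p) b"
  unfolding exponents_le_def by (simp add: in_keys_iff)

lemma exponents_le_diff: "exponents_le p b \<Longrightarrow> exponents_le q b \<Longrightarrow> exponents_le (p - q) b"
  using exponents_le_add[OF _ exponents_le_uminus, of p b q] by simp

lemma exponents_le_one: "exponents_le 1 b"
  by (simp add: exponents_le_def)

lemma exponents_le_mult:
  assumes "exponents_le p b" "exponents_le q b'"
  shows "exponents_le (p * q) (\<lambda>i. b i + b' i)"
  unfolding exponents_le_def
proof (intro ballI allI)
  fix e i assume "e \<in> Poly_Mapping.keys (p * q)"
  then obtain d d' where "d \<in> Poly_Mapping.keys p" "d' \<in> Poly_Mapping.keys q" "e = d + d'"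
    using keys_mult[of p q] by blast
  then show "Poly_Mapping.lookup e i \<le> b i + b' i"
    using assms by (auto simp: exponents_le_def lookup_add intro: add_mono)
qed

lemma exponents_le_chebyshev:
  "exponents_le (chebyshev_T k (Var i)) (\<lambda>l. if l = i then k else 0)"
proof (induction k "Var i :: 'a cpoly" rule: chebyshev_T.induct)
  case 1
  show ?case by (simp add: exponents_le_one)
next
  case 2
  show ?case by (auto simp: exponents_le_def Var_def lookup_single)
next
  case (3 k)
  have "exponents_le (Var i) (\<lambda>l. if l = i then 1 else 0)"
    by (auto simp: exponents_le_def Var_def lookup_single)
  from exponents_le_mult[OF this 3(1)]
  have *: "exponents_le (Var i * chebyshev_T (Suc k) (Var i)) (\<lambda>l. if l = i then Suc (Suc k) else 0)"
    by (rule exponents_le_mono) auto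
  have "exponents_le (chebyshev_T k (Var i)) (\<lambda>l. if l = i then Suc (Suc k) else 0)"
    using 3(2) by (rule exponents_le_mono) auto
  from exponents_le_diff[OF exponents_le_add[OF * *] this] show ?case
    unfolding chebyshev_T.simps mult_2 distrib_right .
qed

lemma exponents_le_tensor_chebyshev:
  "exponents_le (tensor_chebyshev A j) (\<lambda>i. A $ i $ j)"
proof -
  have "exponents_le (\<Prod>i\<in>S. chebyshev_T (A $ i $ j) (Var i)) (\<lambda>i. if i \<in> S then A $ i $ j else 0)"
    if "finite S" for S
    using that
  proof induction
    case empty
    show ?case by (simp add: exponents_le_one)
  next
    case (insert k S)
    from exponents_le_mult[OF exponents_le_chebyshev insert.IH, of "A $ k $ j" k]
    have "exponents_le (chebyshev_T (A $ k $ j) (Var k) * (\<Prod>i\<in>S. chebyshev_T (A $ i $ j) (Var i)))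
        (\<lambda>i. if i \<in> insert k S then A $ i $ j else 0)"
      using insert.hyps by (elim exponents_le_mono) auto
    then show ?case using insert.hyps by simp
  qed
  from this[of UNIV] show ?thesis unfolding tensor_chebyshev_def by simp
qed

lemma compact_P_C: "compact (P_C A)" and convex_P_C: "convex (P_C A)" and zero_in_P_C: "0 \<in> P_C A"
proof -
  show "compact (P_C A)" unfolding P_C_def newton_polytope_def
    by (intro compact_convex_hull compact_Un compact_UN) (auto intro!: finite_imp_compact)
  show "convex (P_C A)" unfolding P_C_def by (rule convex_convex_hull)
  show "0 \<in> P_C A" unfolding P_C_def by (rule hull_inc) simp
qed

lemma tensor_chebyshev_monomial_span:
  "poly_eval (tensor_chebyshev A j) \<in> monomial_span (lattice_points (P_C A) 1)"
proof -
  let ?p = "tensor_chebyshev A j"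
  let ?S = "Poly_Mapping.lookup ` Poly_Mapping.keys ?p"
  have "poly_eval ?p \<in> monomial_span ?S"
  proof (rule monomial_spanI)
    fix x :: "'a \<Rightarrow> complex"
    have "(\<Prod>i\<in>Poly_Mapping.keys e. x i ^ Poly_Mapping.lookup e i) =
        (\<Prod>i\<in>UNIV. x i ^ Poly_Mapping.lookup e i)" for e
      by (rule prod.mono_neutral_left) (auto simp: in_keys_iff)
    moreover have "inj_on Poly_Mapping.lookup (Poly_Mapping.keys ?p)"
      by (simp add: inj_on_def poly_mapping.lookup_inject)
    ultimately show "poly_eval ?p x =
        (\<Sum>e\<in>?S. Poly_Mapping.lookup ?p (Abs_poly_mapping e) * (\<Prod>i\<in>UNIV. x i ^ e i))"
      by (simp add: poly_eval_def sum.reindex poly_mapping.lookup_inverse)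
  qed
  moreover have "?S \<subseteq> lattice_points (P_C A) 1"
  proof
    fix e assume "e \<in> ?S"
    then have "(\<chi> i. real (e i)) \<in> newton_polytope ?p"
      unfolding newton_polytope_def by (intro hull_inc) auto
    then have "(\<chi> i. real (e i)) \<in> P_C A"
      unfolding P_C_def by (intro hull_inc) auto
    then show "e \<in> lattice_points (P_C A) 1" by (simp add: lattice_points_def)
  qed
  ultimately show ?thesis
    using finite_lattice_points[OF compact_imp_bounded[OF compact_P_C]] by (rule monomial_span_mono)
qed

section \<open>Volumes of the two polytopes\<close>

text \<open>
  Coordinates are moved to the boundary of the box one at a time; \<open>S\<close> collects those that are still
  inside.
\<close>

lemma box_subset_hull_vertices:
  fixes a :: "'m::finite \<Rightarrow> real"
  assumes "\<And>i. \<bar>v $ i\<bar> \<le> a i"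
  shows "v \<in> convex hull {v. \<forall>i. v $ i \<in> {- a i, a i}}" (is "_ \<in> ?H")
proof -
  have "v \<in> ?H" if "finite S" "\<And>i. \<bar>v $ i\<bar> \<le> a i" "\<And>i. i \<notin> S \<Longrightarrow> v $ i \<in> {- a i, a i}" for S v
    using that
  proof (induction S arbitrary: v rule: finite_induct)
    case empty
    then show ?case by (intro hull_inc) auto
  next
    case (insert k S)
    show ?case
    proof (cases "a k = 0")
      case True
      show ?thesis
      proof (rule insert.IH)
        fix i assume "i \<notin> S"
        then show "v $ i \<in> {- a i, a i}"
          using insert.prems(1)[of i] insert.prems(2)[of i] True by (cases "i = k") auto
      qed (rule insert.prems)
    next
      case False
      then have ak: "a k > 0" using insert.prems(1)[of k] by linarith
      define w where "w = (\<lambda>z. \<chi> i. if i = k then z else v $ i)"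
      have "w z \<in> ?H" if "z \<in> {- a k, a k}" for z
        using insert.prems that ak by (intro insert.IH) (auto simp: w_def)
      then have w: "w (- a k) \<in> ?H" "w (a k) \<in> ?H" by auto
      define u where "u = (v $ k + a k) / (2 * a k)"
      have u: "0 \<le> u" "u \<le> 1" using insert.prems(1)[of k] ak by (auto simp: u_def field_simps)
      have "(1 - u) *\<^sub>R w (- a k) + u *\<^sub>R w (a k) = v"
        using ak by (auto simp: vec_eq_iff w_def u_def field_simps)
      then show ?thesis using convexD_alt[OF convex_convex_hull w u] by simp
    qed
  qed
  from this[of UNIV v] show ?thesis using assms by simp
qed

definition reflection :: "('m \<Rightarrow> real) \<Rightarrow> real^'m \<Rightarrow> real^'m" where
  "reflection s x = (\<chi> i. s i * x $ i)"

lemma linear_reflection: "linear (reflection s)"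
  by (rule linearI) (simp_all add: reflection_def vec_eq_iff algebra_simps)

lemma measure_reflection_vimage:
  fixes s :: "'m::finite \<Rightarrow> real"
  assumes s: "\<And>i. \<bar>s i\<bar> = 1" and Q: "Q \<in> sets lebesgue"
  shows "reflection s -` Q \<in> sets lebesgue"
    and "measure lebesgue (reflection s -` Q) = measure lebesgue Q"
proof -
  define c :: "real^'m \<Rightarrow> real" where "c b = (\<Sum>i\<in>UNIV. s i * b $ i)" for b
  have c: "c (axis i 1) = s i" for i
    by (simp add: c_def axis_def if_distrib[of "\<lambda>x. _ * x"] cong: if_cong)
  have c0: "c b \<noteq> 0" and c1: "\<bar>c b\<bar> = 1" if "b \<in> Basis" for b
    using that s c by (auto simp: Basis_vec_def) (metis abs_zero zero_neq_one)
  define R where "R = (\<lambda>x :: real^'m. 0 + (\<Sum>b\<in>Basis. (c b * (x \<bullet> b)) *\<^sub>R b))"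
  have R: "R = reflection s"
  proof
    fix x
    have "R x $ i = s i * x $ i" for i
    proof -
      have "R x $ i = R x \<bullet> axis i 1" by (simp add: cart_eq_inner_axis)
      also have "\<dots> = c (axis i 1) * (x \<bullet> axis i 1)"
        unfolding R_def by (simp add: axis_in_Basis_iff)
      finally show ?thesis by (simp add: c cart_eq_inner_axis)
    qed
    then show "R x = reflection s x" by (simp add: vec_eq_iff reflection_def)
  qed
  have R_meas: "R \<in> lebesgue \<rightarrow>\<^sub>M lebesgue"
    unfolding R_def using c0 by (rule lebesgue_affine_measurable)
  then show "reflection s -` Q \<in> sets lebesgue"
    using measurable_sets[OF R_meas Q] by (simp add: R)
  have "lebesgue = density (distr lebesgue lebesgue R) (\<lambda>_. (\<Prod>b\<in>Basis. \<bar>c b\<bar>))"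
    unfolding R_def using c0 by (rule lebesgue_affine_euclidean)
  also have "(\<Prod>b\<in>Basis. \<bar>c b\<bar>) = 1" using c1 by simp
  finally have leb: "(lebesgue :: (real^'m) measure) = distr lebesgue lebesgue R"
    by (simp add: density_1)
  have "emeasure lebesgue Q = emeasure (distr lebesgue lebesgue R) Q" using leb by metis
  also have "\<dots> = emeasure lebesgue (R -` Q)" using emeasure_distr[OF R_meas Q] by simp
  finally show "measure lebesgue (reflection s -` Q) = measure lebesgue Q"
    by (simp add: measure_def R)
qed

lemma open_positive_orthant: "open {x :: real^'m::finite. \<forall>i. 0 < x $ i}"
proof -
  have "{x :: real^'m. \<forall>i. 0 < x $ i} = (\<Inter>i. {x. 0 < x $ i})" by auto
  also have "open \<dots>" by (intro open_INT ballI open_Collect_less continuous_intros) auto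
  finally show ?thesis .
qed

text \<open>
  The \<open>2 ^ CARD('m)\<close> mirror images of the part of \<open>P\<close> in the open positive orthant are disjoint,
  have equal volume and lie in \<open>P\<close>.
\<close>

lemma measure_positive_orthant_le:
  fixes P :: "(real^'m) set"
  assumes P: "compact P" and inv: "\<And>s. (\<And>i. s i \<in> {-1, 1}) \<Longrightarrow> reflection s ` P \<subseteq> P"
  shows "2 ^ CARD('m) * measure lebesgue (P \<inter> {x. \<forall>i. 0 < x $ i}) \<le> measure lebesgue P"
proof -
  define Q where "Q = P \<inter> {x. \<forall>i. 0 < x $ i}"
  define \<Sigma> where "\<Sigma> = PiE (UNIV :: 'm set) (\<lambda>_. {-1, 1 :: real})"
  have \<Sigma>: "s i \<in> {-1, 1}" if "s \<in> \<Sigma>" for s i using that by (auto simp: \<Sigma>_def PiE_iff)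
  have abs: "\<bar>s i\<bar> = 1" if "s \<in> \<Sigma>" for s i using \<Sigma>[OF that, of i] by auto
  have card: "finite \<Sigma>" "card \<Sigma> = 2 ^ CARD('m)"
    by (auto simp: \<Sigma>_def card_PiE numeral_2_eq_2 intro!: finite_PiE)
  have Pm: "P \<in> lmeasurable" using P by (rule lmeasurable_compact)
  have Qm: "Q \<in> sets lebesgue" unfolding Q_def using Pm open_positive_orthant by auto
  have sub: "reflection s -` Q \<subseteq> P" if s: "s \<in> \<Sigma>" for s
  proof
    fix x assume "x \<in> reflection s -` Q"
    then have "reflection s (reflection s x) \<in> P" using inv[of s] \<Sigma>[OF s] by (auto simp: Q_def)
    moreover have "s i * (s i * z) = z" for i z using \<Sigma>[OF s, of i] by auto
    then have "reflection s (reflection s x) = x" by (simp add: reflection_def vec_eq_iff)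
    ultimately show "x \<in> P" by simp
  qed
  have meas: "reflection s -` Q \<in> lmeasurable" if "s \<in> \<Sigma>" for s
    using measure_reflection_vimage(1)[OF abs[OF that] Qm] sub[OF that] Pm
    by (meson fmeasurableI2)
  have disj: "disjnt (reflection s -` Q) (reflection s' -` Q)" if "s \<in> \<Sigma>" "s' \<in> \<Sigma>" "s \<noteq> s'" for s s'
  proof -
    obtain i where "s i \<noteq> s' i" using \<open>s \<noteq> s'\<close> by auto
    then have "s' i = - s i" using \<Sigma>[OF that(1), of i] \<Sigma>[OF that(2), of i] by auto
    then have False if "0 < s i * x $ i" "0 < s' i * x $ i" for x using that by simp
    then show ?thesis unfolding disjnt_iff by (auto simp: Q_def reflection_def)
  qed
  have "2 ^ CARD('m) * measure lebesgue Q = (\<Sum>s\<in>\<Sigma>. measure lebesgue (reflection s -` Q))"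
    using card by (simp add: measure_reflection_vimage(2)[OF _ Qm] abs)
  also have "\<dots> = measure lebesgue (\<Union>s\<in>\<Sigma>. reflection s -` Q)"
    using card meas disj by (intro measure_UNION'[symmetric]) (auto simp: pairwise_def)
  also have "\<dots> \<le> measure lebesgue P"
    using sub meas card Pm by (intro measure_mono_fmeasurable) (auto intro!: sets.finite_UN)
  finally show ?thesis by (simp add: Q_def)
qed

lemma compact_P_B:
  fixes A :: "nat^'n^'m"
  shows "compact (P_B A)"
proof -
  have "finite {v :: real^'m. \<forall>i. v $ i \<in> {- real (A $ i $ j), real (A $ i $ j)}}" for j
  proof (rule finite_subset)
    let ?F = "\<lambda>i. {- real (A $ i $ j), real (A $ i $ j)}"
    show "finite (vec_lambda ` PiE UNIV ?F :: (real^'m) set)" by (intro finite_imageI finite_PiE) auto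
    show "{v. \<forall>i. v $ i \<in> ?F i} \<subseteq> vec_lambda ` PiE UNIV ?F"
    proof
      fix v assume "v \<in> {v. \<forall>i. v $ i \<in> ?F i}"
      then have "($) v \<in> PiE UNIV ?F" by auto
      then show "v \<in> vec_lambda ` PiE UNIV ?F" by (rule image_eqI[rotated]) simp
    qed
  qed
  then show ?thesis unfolding P_B_def by (intro finite_imp_compact_convex_hull finite_UN_I) auto
qed

lemma reflection_P_B:
  assumes s: "\<And>i. s i \<in> {-1, 1}"
  shows "reflection s ` P_B A \<subseteq> P_B A"
  unfolding P_B_def convex_hull_linear_image[OF linear_reflection]
proof (rule hull_mono, clarsimp simp: reflection_def)
  fix j v assume v: "\<forall>i. v $ i = - real (A $ i $ j) \<or> v $ i = real (A $ i $ j)"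
  have "s i * v $ i = - real (A $ i $ j) \<or> s i * v $ i = real (A $ i $ j)" for i
    using s[of i] v[rule_format, of i] by auto
  then show "\<exists>j. \<forall>i. s i * v $ i = - real (A $ i $ j) \<or> s i * v $ i = real (A $ i $ j)" by blast
qed

lemma P_C_subset:
  fixes A :: "nat^'n^'m"
  shows "P_C A \<subseteq> P_B A \<inter> {x. \<forall>i. 0 \<le> x $ i}"
proof -
  have box: "v \<in> P_B A" if "\<And>i. \<bar>v $ i\<bar> \<le> real (A $ i $ j)" for v j
    using box_subset_hull_vertices[OF that]
      hull_mono[of "{v. \<forall>i. v $ i \<in> {- real (A $ i $ j), real (A $ i $ j)}}"
        "\<Union>j. {v. \<forall>i. v $ i \<in> {- real (A $ i $ j), real (A $ i $ j)}}" convex]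
    unfolding P_B_def by blast
  have "convex {x :: real^'m. \<forall>i. 0 \<le> x $ i}"
    by (auto simp: convex_def)
  then have conv: "convex (P_B A \<inter> {x. \<forall>i. 0 \<le> x $ i})"
    by (intro convex_Int) (auto simp: P_B_def)
  have "newton_polytope (tensor_chebyshev A j) \<subseteq> P_B A \<inter> {x. \<forall>i. 0 \<le> x $ i}" for j
    unfolding newton_polytope_def
  proof (rule hull_minimal[where S = convex, OF _ conv])
    show "(\<lambda>e. \<chi> i. real (Poly_Mapping.lookup e i)) ` Poly_Mapping.keys (tensor_chebyshev A j)
        \<subseteq> P_B A \<inter> {x. \<forall>i. 0 \<le> x $ i}"
      using exponents_le_tensor_chebyshev[of A j]
      by (auto simp: exponents_le_def intro!: box[of _ j])
  qed
  moreover have "0 \<in> P_B A" by (rule box) simp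
  ultimately show ?thesis
    unfolding P_C_def by (intro hull_minimal[where S = convex, OF _ conv]) auto
qed

lemma volume_P_C_le:
  fixes A :: "nat^'n^'m"
  shows "measure lebesgue (P_C A) \<le> (1/2) ^ CARD('m) * measure lebesgue (P_B A)"
proof -
  let ?Q = "P_B A \<inter> {x. \<forall>i. 0 < x $ i}"
  let ?N = "\<Union>i. {x :: real^'m. x $ i = 0}"
  have N: "negligible ?N"
    by (intro negligible_Union) (auto intro: negligible_standard_hyperplane_cart)
  have Q: "?Q \<in> lmeasurable"
    using lmeasurable_compact[OF compact_P_B, of A] open_positive_orthant
    by (intro fmeasurable_Int_fmeasurable) auto
  have "P_C A \<subseteq> ?Q \<union> ?N" using P_C_subset[of A] by (auto simp: less_le)
  then have "measure lebesgue (P_C A) \<le> measure lebesgue (?Q \<union> ?N)"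
    using lmeasurable_compact[OF compact_P_C, of A] Q N
    by (intro measure_mono_fmeasurable) (auto simp: negligible_iff_measure)
  also have "\<dots> \<le> measure lebesgue ?Q + measure lebesgue ?N"
    using Q N by (intro measure_Un_le) (auto simp: negligible_iff_measure)
  also have "\<dots> = measure lebesgue ?Q" using N by (simp add: negligible_iff_measure)
  finally have "2 ^ CARD('m) * measure lebesgue (P_C A) \<le> measure lebesgue (P_B A)"
    using measure_positive_orthant_le[OF compact_P_B reflection_P_B, of A]
    by (meson mult_left_mono order_trans zero_le_numeral zero_le_power)
  then show ?thesis by (simp add: power_divide field_simps)
qed

section \<open>The degree bound\<close>

theorem proposition4p4:
  fixes A :: "nat^'n^'m"
  assumes "variety_dim (chebyshev_variety A) = enat CARD('m)"
  shows "real (variety_degree (chebyshev_variety A))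
           \<le> fact CARD('m) * measure lebesgue (P_C A)
       \<and> fact CARD('m) * measure lebesgue (P_C A)
           \<le> fact CARD('m) * (1/2) ^ CARD('m) * measure lebesgue (P_B A)"
proof
  let ?d = "CARD('m)"
  let ?V = "{..<?d} \<times> (UNIV :: 'n option set)"
  interpret parametrized_variety "\<lambda>j. poly_eval (tensor_chebyshev A j)" ?d
    by standard (auto intro: polyfuns_poly_eval)
  have X: "X = chebyshev_variety A" unfolding X_def chebyshev_variety_def ..
  have "?d \<le> CARD('n)" using variety_dim_le_card[OF assms] .
  obtain g r where g: "g \<noteq> 0" and count: "\<And>c. pf_eval g c \<noteq> 0 \<Longrightarrow>
      finite (X \<inter> linear_section ?d c) \<and> card (X \<inter> linear_section ?d c) = r \<and>
      inj_on (\<lambda>x. linear_form ?d c (($) x)) (X \<inter> linear_section ?d c)"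
    using generic_section_count by blast
  obtain f where f: "f \<in> polyfuns" "\<exists>c. f c \<noteq> 0" "\<And>c. f c \<noteq> 0 \<Longrightarrow>
      affine_linear_space (CARD('n) - ?d) (linear_section ?d c :: (complex^'n) set)"
    using generic_linear_section_dim[OF \<open>?d \<le> CARD('n)\<close>] by blast
  let ?P = "\<lambda>N c. affine_linear_space (CARD('n) - ?d) (linear_section ?d c :: (complex^'n) set) \<and>
       finite (chebyshev_variety A \<inter> linear_section ?d c) \<and>
       card (chebyshev_variety A \<inter> linear_section ?d c) = N"
  have "\<not> (\<forall>c. pf_eval g c * f c = 0)"
    using polyfuns_no_zero_divisors[OF pf_eval f(1), of g] g f(2) polyfun_nonzero_iff[of g] by blast
  then obtain c0 where c0: "pf_eval g c0 * f c0 \<noteq> 0" by blast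
  have gen: "generically ?V (?P r)"
  proof (rule genericallyI[OF polyfuns.mult[OF pf_eval f(1)], of g c0])
    fix c
    let ?c = "\<lambda>v. if v \<in> ?V then c v else c0 v"
    assume "pf_eval g ?c * f ?c \<noteq> 0"
    moreover have "linear_section ?d ?c = (linear_section ?d c :: (complex^'n) set)"
      by (simp add: linear_section_def)
    ultimately show "?P r c" using count[of ?c] f(3)[of ?c] by (simp add: X)
  qed (rule c0)
  have "variety_degree (chebyshev_variety A) = r"
    unfolding variety_degree_def assms Let_def the_enat.simps
  proof (rule the_equality[of "\<lambda>N. generically ?V (?P N)", OF gen])
    fix N assume "generically ?V (?P N)"
    from generically_unique[OF this gen] show "N = r" by blast
  qed
  moreover have "real r \<le> fact ?d * measure lebesgue (P_C A)"
    using count by (intro section_count_le_volume[OF compact_P_C convex_P_C zero_in_P_C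
      tensor_chebyshev_monomial_span g]) blast
  ultimately show "real (variety_degree (chebyshev_variety A)) \<le> fact ?d * measure lebesgue (P_C A)"
    by simp
  show "fact ?d * measure lebesgue (P_C A) \<le> fact ?d * (1/2) ^ ?d * measure lebesgue (P_B A)"
    using volume_P_C_le[of A] by (simp add: mult.assoc)
qed

end
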